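(* For every set of sentences (closed formulas) $\Gamma\cup\{\varphi\}\subseteq Sen(\Omega)$: if $\Gamma\models_{\mathbf{RQmbC}}\varphi$ then $\Gamma\vdash_{\mathbf{RQmbC}}\varphi$.
   Context: Let $\Sigma=\{\wedge,\vee,\to,\neg,\circ\}$ ($\neg,\circ$ unary). A first-order signature $\Omega$ extending $\Sigma$ consists of $\Sigma$ together with a (possibly empty) denumerable set $\mathcal C$ of individual constants and, for each $n\ge1$, (possibly empty) denumerable sets $\mathcal F_n$, $\mathcal P_n$ of $n$-ary function and predicate symbols, with $\bigcup_n\mathcal P_n\ne\emptyset$. $Var$ is a fixed denumerable set of individual variables. Terms are built from $Var\cup\mathcal C$ by function symbols; $For_1(\Omega)$ is generated from atomic formulas $P(\tau_1,\dots,\tau_n)$ by the connectives in $\Sigma$ and the quantifiers $\forall x,\exists x$ ($x\in Var$); $Sen(\Omega)$ is the set of formulas without free variables. $\alpha\leftrightarrow\beta$ abbreviates $(\alpha\to\beta)\wedge(\beta\to\alpha)$; $\varphi[x/t]$ is the substitution of $t$ for the free occurrences of $x$. $\mathbf{RQmbC}$ is the Hilbert calculus over $For_1(\Omega)$ with axiom schemas: (Ax1) $\alpha\to(\beta\to\alpha)$; (Ax2) $(\alpha\to(\beta\to\gamma))\to((\alpha\to\beta)\to(\alpha\to\gamma))$; (Ax3) $\alpha\to(\beta\to(\alpha\wedge\beta))$; (Ax4) $(\alpha\wedge\beta)\to\alpha$; (Ax5) $(\alpha\wedge\beta)\to\beta$; (Ax6) $\alpha\to(\alpha\vee\beta)$;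 (Ax7) $\beta\to(\alpha\vee\beta)$; (Ax8) $(\alpha\to\gamma)\to((\beta\to\gamma)\to((\alpha\vee\beta)\to\gamma))$; (Ax9) $(\alpha\to\beta)\vee\alpha$; (Ax10) $\alpha\vee\neg\alpha$; (bc1) $\circ\alpha\to(\alpha\to(\neg\alpha\to\beta))$; (Ax$\exists$) $\varphi[x/t]\to\exists x\varphi$ and (Ax$\forall$) $\forall x\varphi\to\varphi[x/t]$, for $t$ a term free for $x$ in $\varphi$; and rules: (MP) from $\alpha$, $\alpha\to\beta$ infer $\beta$; $(\mathbf R_\neg)$ from $\alpha\leftrightarrow\beta$ infer $\neg\alpha\leftrightarrow\neg\beta$; $(\mathbf R_\circ)$ from $\alpha\leftrightarrow\beta$ infer $\circ\alpha\leftrightarrow\circ\beta$; ($\exists$-In) from $\varphi\to\psi$ infer $\exists x\varphi\to\psi$, if $x$ is not free in $\psi$; ($\forall$-In) from $\varphi\to\psi$ infer $\varphi\to\forall x\psi$, if $x$ is not free in $\varphi$. $\vdash_{\mathbf{RQmbC}}\varphi$ means there is a finite sequence of formulas ending in $\varphi$ each of which is an instance of an axiom schema or follows from earlier ones by a rule. $\Gamma\vdash_{\mathbf{RQmbC}}\varphi$ means that either $\vdash_{\mathbf{RQmbC}}\varphi$ or there is a finite non-empty $\{\gamma_1,\dots,\gamma_n\}\subseteq\Gamma$ with $\vdash_{\mathbf{RQmbC}}(\gamma_1\wedge(\cdots\wedge(\gamma_{n-1}\wedge\gamma_n)\cdots))\to\varphi$. A BALFI is an algebra $\mathcal B=\langle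 A,\wedge,\vee,\to,\neg,\circ,0,1\rangle$ such that $\langle A,\wedge,\vee,\to,0,1\rangle$ is a Boolean algebra (with $\to$ the Boolean implication) and $a\vee\neg a=1$, $a\wedge\neg a\wedge\circ a=0$ for all $a\in A$; it is complete if its Boolean reduct is complete. A structure over $\Omega$ is $\mathfrak A=\langle U,\mathcal B,I_{\mathfrak A}\rangle$ with $U\neq\emptyset$, $\mathcal B$ a complete BALFI with carrier $A$, and $I_{\mathfrak A}$ interpreting each constant $c$ as $c^{\mathfrak A}\in U$, each $n$-ary function symbol $f$ as $f^{\mathfrak A}:U^n\to U$, each $n$-ary predicate symbol $P$ as $P^{\mathfrak A}:U^n\to A$. An assignment is $\mu:Var\to U$; $\mu^x_a$ agrees with $\mu$ except $\mu^x_a(x)=a$. Terms are interpreted as usual by $[\![t]\!]^{\mathfrak A}_\mu\in U$. Formulas are interpreted in $A$ by: $[\![P(t_1,\dots,t_n)]\!]_\mu=P^{\mathfrak A}([\![t_1]\!]_\mu,\dots,[\![t_n]\!]_\mu)$; $[\![\#\varphi]\!]_\mu=\#[\![\varphi]\!]_\mu$ for $\#\in\{\neg,\circ\}$; $[\![\varphi\#\psi]\!]_\mu=[\![\varphi]\!]_\mu\#[\![\psi]\!]_\mu$ for $\#\in\{\wedge,\vee,\to\}$; $[\![\forall x\varphi]\!]_\mu=\bigwedge_{a\in U}[\![\varphi]\!]_{\mu^x_a}$; $[\![\exists x\varphi]\!]_\mu=\bigvee_{a\in U}[\![\varphi]\!]_{\mu^x_a}$. $\models_{\mathbf{RQmbC}}\varphi$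 means $[\![\varphi]\!]^{\mathfrak A}_\mu=1$ for every structure $\mathfrak A$ over $\Omega$ and every assignment $\mu$. $\Gamma\models_{\mathbf{RQmbC}}\varphi$ means that either $\models_{\mathbf{RQmbC}}\varphi$ or there is a finite non-empty $\{\gamma_1,\dots,\gamma_n\}\subseteq\Gamma$ with $\models_{\mathbf{RQmbC}}(\gamma_1\wedge\cdots\wedge\gamma_n)\to\varphi$. *)

theory Defs
  imports
    "HOL-Algebra.Complete_Lattice"
    "HOL-Library.Countable_Set"
    "HOL-Library.Equipollence"
begin

section \<open>Syntax\<close>

text \<open>
  Individual variables are the natural numbers. The arity of an occurrence of a function or
  predicate symbol is the length of its argument list; the type of raw terms and formulas does not
  constrain it, the predicates \<open>wf_term\<close> and \<open>wf_form\<close> below do.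
\<close>

datatype ('c, 'f) tm =
    Var nat
  | Cst 'c
  | Fn 'f "('c, 'f) tm list"

datatype ('c, 'f, 'p) fm =
    Atom 'p "('c, 'f) tm list"
  | And "('c, 'f, 'p) fm" "('c, 'f, 'p) fm"
  | Or "('c, 'f, 'p) fm" "('c, 'f, 'p) fm"
  | Imp "('c, 'f, 'p) fm" "('c, 'f, 'p) fm"
  | Neg "('c, 'f, 'p) fm"
  | Circ "('c, 'f, 'p) fm"
  | Forall nat "('c, 'f, 'p) fm"
  | Exists nat "('c, 'f, 'p) fm"

abbreviation Iff :: "('c, 'f, 'p) fm \<Rightarrow> ('c, 'f, 'p) fm \<Rightarrow> ('c, 'f, 'p) fm" where
  "Iff \<alpha> \<beta> \<equiv> And (Imp \<alpha> \<beta>) (Imp \<beta> \<alpha>)"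

text \<open>
  \<open>sig_funs \<Omega> n\<close> and \<open>sig_preds \<Omega> n\<close> are the sets of \<open>n\<close>-ary symbols; the value at \<open>n = 0\<close> is never
  used. ``Possibly empty denumerable'' is read as countable.
\<close>

record ('c, 'f, 'p) signature =
  sig_csts :: "'c set"
  sig_funs :: "nat \<Rightarrow> 'f set"
  sig_preds :: "nat \<Rightarrow> 'p set"

definition is_signature :: "('c, 'f, 'p) signature \<Rightarrow> bool" where
  "is_signature \<Omega> \<longleftrightarrow>
     countable (sig_csts \<Omega>) \<and>
     (\<forall>n\<ge>1. countable (sig_funs \<Omega> n) \<and> countable (sig_preds \<Omega> n)) \<and>
     (\<Union>n\<in>{1..}. sig_preds \<Omega> n) \<noteq> {}"

fun wf_term :: "('c, 'f, 'p) signature \<Rightarrow> ('c, 'f) tm \<Rightarrow> bool" where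
  "wf_term \<Omega> (Var x) \<longleftrightarrow> True"
| "wf_term \<Omega> (Cst c) \<longleftrightarrow> c \<in> sig_csts \<Omega>"
| "wf_term \<Omega> (Fn f ts) \<longleftrightarrow>
     length ts \<ge> 1 \<and> f \<in> sig_funs \<Omega> (length ts) \<and> (\<forall>t\<in>set ts. wf_term \<Omega> t)"

fun wf_form :: "('c, 'f, 'p) signature \<Rightarrow> ('c, 'f, 'p) fm \<Rightarrow> bool" where
  "wf_form \<Omega> (Atom P ts) \<longleftrightarrow>
     length ts \<ge> 1 \<and> P \<in> sig_preds \<Omega> (length ts) \<and> (\<forall>t\<in>set ts. wf_term \<Omega> t)"
| "wf_form \<Omega> (And \<alpha> \<beta>) \<longleftrightarrow> wf_form \<Omega> \<alpha> \<and> wf_form \<Omega> \<beta>"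
| "wf_form \<Omega> (Or \<alpha> \<beta>) \<longleftrightarrow> wf_form \<Omega> \<alpha> \<and> wf_form \<Omega> \<beta>"
| "wf_form \<Omega> (Imp \<alpha> \<beta>) \<longleftrightarrow> wf_form \<Omega> \<alpha> \<and> wf_form \<Omega> \<beta>"
| "wf_form \<Omega> (Neg \<alpha>) \<longleftrightarrow> wf_form \<Omega> \<alpha>"
| "wf_form \<Omega> (Circ \<alpha>) \<longleftrightarrow> wf_form \<Omega> \<alpha>"
| "wf_form \<Omega> (Forall x \<alpha>) \<longleftrightarrow> wf_form \<Omega> \<alpha>"
| "wf_form \<Omega> (Exists x \<alpha>) \<longleftrightarrow> wf_form \<Omega> \<alpha>"

definition For1 :: "('c, 'f, 'p) signature \<Rightarrow> ('c, 'f, 'p) fm set" where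
  "For1 \<Omega> = {\<phi>. wf_form \<Omega> \<phi>}"

fun vars_tm :: "('c, 'f) tm \<Rightarrow> nat set" where
  "vars_tm (Var x) = {x}"
| "vars_tm (Cst c) = {}"
| "vars_tm (Fn f ts) = (\<Union>t\<in>set ts. vars_tm t)"

fun free_vars :: "('c, 'f, 'p) fm \<Rightarrow> nat set" where
  "free_vars (Atom P ts) = (\<Union>t\<in>set ts. vars_tm t)"
| "free_vars (And \<alpha> \<beta>) = free_vars \<alpha> \<union> free_vars \<beta>"
| "free_vars (Or \<alpha> \<beta>) = free_vars \<alpha> \<union> free_vars \<beta>"
| "free_vars (Imp \<alpha> \<beta>) = free_vars \<alpha> \<union> free_vars \<beta>"
| "free_vars (Neg \<alpha>) = free_vars \<alpha>"
| "free_vars (Circ \<alpha>) = free_vars \<alpha>"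
| "free_vars (Forall x \<alpha>) = free_vars \<alpha> - {x}"
| "free_vars (Exists x \<alpha>) = free_vars \<alpha> - {x}"

definition Sen :: "('c, 'f, 'p) signature \<Rightarrow> ('c, 'f, 'p) fm set" where
  "Sen \<Omega> = {\<phi> \<in> For1 \<Omega>. free_vars \<phi> = {}}"

fun subst_tm :: "nat \<Rightarrow> ('c, 'f) tm \<Rightarrow> ('c, 'f) tm \<Rightarrow> ('c, 'f) tm" where
  "subst_tm x t (Var y) = (if y = x then t else Var y)"
| "subst_tm x t (Cst c) = Cst c"
| "subst_tm x t (Fn f ts) = Fn f (map (subst_tm x t) ts)"

text \<open>
  \<open>subst x t \<phi>\<close> is \<open>\<phi>[x/t]\<close>. Bound variables are not renamed; capture is excluded by \<open>free_for\<close>: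
  no free occurrence of \<open>x\<close> in \<open>\<phi>\<close> lies in the scope of a quantifier binding a variable of \<open>t\<close>.
\<close>

fun subst :: "nat \<Rightarrow> ('c, 'f) tm \<Rightarrow> ('c, 'f, 'p) fm \<Rightarrow> ('c, 'f, 'p) fm" where
  "subst x t (Atom P ts) = Atom P (map (subst_tm x t) ts)"
| "subst x t (And \<alpha> \<beta>) = And (subst x t \<alpha>) (subst x t \<beta>)"
| "subst x t (Or \<alpha> \<beta>) = Or (subst x t \<alpha>) (subst x t \<beta>)"
| "subst x t (Imp \<alpha> \<beta>) = Imp (subst x t \<alpha>) (subst x t \<beta>)"
| "subst x t (Neg \<alpha>) = Neg (subst x t \<alpha>)"
| "subst x t (Circ \<alpha>) = Circ (subst x t \<alpha>)"
| "subst x t (Forall y \<alpha>) = Forall y (if y = x then \<alpha> else subst x t \<alpha>)"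
| "subst x t (Exists y \<alpha>) = Exists y (if y = x then \<alpha> else subst x t \<alpha>)"

fun free_for :: "nat \<Rightarrow> ('c, 'f) tm \<Rightarrow> ('c, 'f, 'p) fm \<Rightarrow> bool" where
  "free_for x t (Atom P ts) \<longleftrightarrow> True"
| "free_for x t (And \<alpha> \<beta>) \<longleftrightarrow> free_for x t \<alpha> \<and> free_for x t \<beta>"
| "free_for x t (Or \<alpha> \<beta>) \<longleftrightarrow> free_for x t \<alpha> \<and> free_for x t \<beta>"
| "free_for x t (Imp \<alpha> \<beta>) \<longleftrightarrow> free_for x t \<alpha> \<and> free_for x t \<beta>"
| "free_for x t (Neg \<alpha>) \<longleftrightarrow> free_for x t \<alpha>"
| "free_for x t (Circ \<alpha>) \<longleftrightarrow> free_for x t \<alpha>"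
| "free_for x t (Forall y \<alpha>) \<longleftrightarrow>
     x \<notin> free_vars (Forall y \<alpha>) \<or> (y \<notin> vars_tm t \<and> free_for x t \<alpha>)"
| "free_for x t (Exists y \<alpha>) \<longleftrightarrow>
     x \<notin> free_vars (Exists y \<alpha>) \<or> (y \<notin> vars_tm t \<and> free_for x t \<alpha>)"

text \<open>\<open>\<gamma>\<^sub>1 \<and> (\<dots> \<and> (\<gamma>\<^sub>n\<^sub>-\<^sub>1 \<and> \<gamma>\<^sub>n)\<dots>)\<close>; only used for non-empty lists.\<close>

fun conj_list :: "('c, 'f, 'p) fm list \<Rightarrow> ('c, 'f, 'p) fm" where
  "conj_list [\<gamma>] = \<gamma>"
| "conj_list (\<gamma> # \<delta> # \<gamma>s) = And \<gamma> (conj_list (\<delta> # \<gamma>s))"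


section \<open>The Hilbert calculus RQmbC\<close>

text \<open>
  Membership in \<open>For1 \<Omega>\<close> is imposed in \<open>derivation\<close> on every formula of a derivation, hence it
  is not repeated in the schemas.
\<close>

inductive_set RQmbC_axioms :: "('c, 'f, 'p) signature \<Rightarrow> ('c, 'f, 'p) fm set"
  for \<Omega> :: "('c, 'f, 'p) signature" where
  Ax1: "Imp \<alpha> (Imp \<beta> \<alpha>) \<in> RQmbC_axioms \<Omega>"
| Ax2: "Imp (Imp \<alpha> (Imp \<beta> \<gamma>)) (Imp (Imp \<alpha> \<beta>) (Imp \<alpha> \<gamma>)) \<in> RQmbC_axioms \<Omega>"
| Ax3: "Imp \<alpha> (Imp \<beta> (And \<alpha> \<beta>)) \<in> RQmbC_axioms \<Omega>"
| Ax4: "Imp (And \<alpha> \<beta>) \<alpha> \<in> RQmbC_axioms \<Omega>"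
| Ax5: "Imp (And \<alpha> \<beta>) \<beta> \<in> RQmbC_axioms \<Omega>"
| Ax6: "Imp \<alpha> (Or \<alpha> \<beta>) \<in> RQmbC_axioms \<Omega>"
| Ax7: "Imp \<beta> (Or \<alpha> \<beta>) \<in> RQmbC_axioms \<Omega>"
| Ax8: "Imp (Imp \<alpha> \<gamma>) (Imp (Imp \<beta> \<gamma>) (Imp (Or \<alpha> \<beta>) \<gamma>)) \<in> RQmbC_axioms \<Omega>"
| Ax9: "Or (Imp \<alpha> \<beta>) \<alpha> \<in> RQmbC_axioms \<Omega>"
| Ax10: "Or \<alpha> (Neg \<alpha>) \<in> RQmbC_axioms \<Omega>"
| bc1: "Imp (Circ \<alpha>) (Imp \<alpha> (Imp (Neg \<alpha>) \<beta>)) \<in> RQmbC_axioms \<Omega>"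
| AxEx: "\<lbrakk>wf_term \<Omega> t; free_for x t \<phi>\<rbrakk> \<Longrightarrow> Imp (subst x t \<phi>) (Exists x \<phi>) \<in> RQmbC_axioms \<Omega>"
| AxAll: "\<lbrakk>wf_term \<Omega> t; free_for x t \<phi>\<rbrakk> \<Longrightarrow> Imp (Forall x \<phi>) (subst x t \<phi>) \<in> RQmbC_axioms \<Omega>"

text \<open>\<open>RQmbC_infers X \<psi>\<close>: \<open>\<psi>\<close> follows from formulas in \<open>X\<close> by one application of a rule.\<close>

inductive RQmbC_infers :: "('c, 'f, 'p) fm set \<Rightarrow> ('c, 'f, 'p) fm \<Rightarrow> bool"
  for X :: "('c, 'f, 'p) fm set" where
  MP: "\<lbrakk>\<alpha> \<in> X; Imp \<alpha> \<beta> \<in> X\<rbrakk> \<Longrightarrow> RQmbC_infers X \<beta>"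
| RNeg: "Iff \<alpha> \<beta> \<in> X \<Longrightarrow> RQmbC_infers X (Iff (Neg \<alpha>) (Neg \<beta>))"
| RCirc: "Iff \<alpha> \<beta> \<in> X \<Longrightarrow> RQmbC_infers X (Iff (Circ \<alpha>) (Circ \<beta>))"
| ExIn: "\<lbrakk>Imp \<phi> \<psi> \<in> X; x \<notin> free_vars \<psi>\<rbrakk> \<Longrightarrow> RQmbC_infers X (Imp (Exists x \<phi>) \<psi>)"
| AllIn: "\<lbrakk>Imp \<phi> \<psi> \<in> X; x \<notin> free_vars \<phi>\<rbrakk> \<Longrightarrow> RQmbC_infers X (Imp \<phi> (Forall x \<psi>))"

definition derivation :: "('c, 'f, 'p) signature \<Rightarrow> ('c, 'f, 'p) fm list \<Rightarrow> bool" where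
  "derivation \<Omega> \<delta>s \<longleftrightarrow>
     (\<forall>i<length \<delta>s. \<delta>s ! i \<in> For1 \<Omega> \<and>
        (\<delta>s ! i \<in> RQmbC_axioms \<Omega> \<or> RQmbC_infers (set (take i \<delta>s)) (\<delta>s ! i)))"

definition provable :: "('c, 'f, 'p) signature \<Rightarrow> ('c, 'f, 'p) fm \<Rightarrow> bool" where
  "provable \<Omega> \<phi> \<longleftrightarrow> (\<exists>\<delta>s. derivation \<Omega> \<delta>s \<and> \<delta>s \<noteq> [] \<and> last \<delta>s = \<phi>)"

definition RQmbC_derives ::
    "('c, 'f, 'p) signature \<Rightarrow> ('c, 'f, 'p) fm set \<Rightarrow> ('c, 'f, 'p) fm \<Rightarrow> bool" where
  "RQmbC_derives \<Omega> \<Gamma> \<phi> \<longleftrightarrow>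
     provable \<Omega> \<phi> \<or>
     (\<exists>\<gamma>s. \<gamma>s \<noteq> [] \<and> set \<gamma>s \<subseteq> \<Gamma> \<and> provable \<Omega> (Imp (conj_list \<gamma>s) \<phi>))"


section \<open>BALFIs\<close>

record 'a balfi = "'a partial_object" +
  bmeet :: "'a \<Rightarrow> 'a \<Rightarrow> 'a"
  bjoin :: "'a \<Rightarrow> 'a \<Rightarrow> 'a"
  bimp :: "'a \<Rightarrow> 'a \<Rightarrow> 'a"
  bneg :: "'a \<Rightarrow> 'a"
  bcirc :: "'a \<Rightarrow> 'a"
  bzero :: 'a
  bone :: 'a

text \<open>
  The Boolean reduct. The complement of \<open>a\<close> is not one of the operations (\<open>bneg\<close> is the
  paraconsistent negation); it is the element \<open>c\<close> in \<open>compl_imp\<close>, and \<open>a \<rightarrow> b\<close> is \<open>c \<or> b\<close>.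
  The one-element algebra is not excluded; every formula takes the value \<open>1\<close> in it.
\<close>

locale boolean_reduct =
  fixes B :: "'a balfi"
  assumes zero_closed: "bzero B \<in> carrier B"
    and one_closed: "bone B \<in> carrier B"
    and meet_closed: "\<lbrakk>a \<in> carrier B; b \<in> carrier B\<rbrakk> \<Longrightarrow> bmeet B a b \<in> carrier B"
    and join_closed: "\<lbrakk>a \<in> carrier B; b \<in> carrier B\<rbrakk> \<Longrightarrow> bjoin B a b \<in> carrier B"
    and imp_closed: "\<lbrakk>a \<in> carrier B; b \<in> carrier B\<rbrakk> \<Longrightarrow> bimp B a b \<in> carrier B"
    and meet_comm: "\<lbrakk>a \<in> carrier B; b \<in> carrier B\<rbrakk> \<Longrightarrow> bmeet B a b = bmeet B b a"
    and join_comm: "\<lbrakk>a \<in> carrier B; b \<in> carrier B\<rbrakk> \<Longrightarrow> bjoin B a b = bjoin B b a"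
    and meet_assoc: "\<lbrakk>a \<in> carrier B; b \<in> carrier B; c \<in> carrier B\<rbrakk> \<Longrightarrow>
      bmeet B (bmeet B a b) c = bmeet B a (bmeet B b c)"
    and join_assoc: "\<lbrakk>a \<in> carrier B; b \<in> carrier B; c \<in> carrier B\<rbrakk> \<Longrightarrow>
      bjoin B (bjoin B a b) c = bjoin B a (bjoin B b c)"
    and meet_absorb: "\<lbrakk>a \<in> carrier B; b \<in> carrier B\<rbrakk> \<Longrightarrow> bmeet B a (bjoin B a b) = a"
    and join_absorb: "\<lbrakk>a \<in> carrier B; b \<in> carrier B\<rbrakk> \<Longrightarrow> bjoin B a (bmeet B a b) = a"
    and meet_distrib: "\<lbrakk>a \<in> carrier B; b \<in> carrier B; c \<in> carrier B\<rbrakk> \<Longrightarrow>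
      bmeet B a (bjoin B b c) = bjoin B (bmeet B a b) (bmeet B a c)"
    and join_distrib: "\<lbrakk>a \<in> carrier B; b \<in> carrier B; c \<in> carrier B\<rbrakk> \<Longrightarrow>
      bjoin B a (bmeet B b c) = bmeet B (bjoin B a b) (bjoin B a c)"
    and zero_least: "a \<in> carrier B \<Longrightarrow> bmeet B a (bzero B) = bzero B"
    and one_greatest: "a \<in> carrier B \<Longrightarrow> bjoin B a (bone B) = bone B"
    and compl_imp: "a \<in> carrier B \<Longrightarrow>
      \<exists>c\<in>carrier B. bmeet B a c = bzero B \<and> bjoin B a c = bone B \<and>
        (\<forall>b\<in>carrier B. bimp B a b = bjoin B c b)"

locale balfi = boolean_reduct +
  assumes neg_closed: "a \<in> carrier B \<Longrightarrow> bneg B a \<in> carrier B"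
    and circ_closed: "a \<in> carrier B \<Longrightarrow> bcirc B a \<in> carrier B"
    and join_neg: "a \<in> carrier B \<Longrightarrow> bjoin B a (bneg B a) = bone B"
    and meet_neg_circ:
      "a \<in> carrier B \<Longrightarrow> bmeet B (bmeet B a (bneg B a)) (bcirc B a) = bzero B"

definition balfi_order :: "'a balfi \<Rightarrow> 'a gorder" where
  "balfi_order B = \<lparr>carrier = carrier B, eq = (=), le = (\<lambda>a b. bmeet B a b = a)\<rparr>"

definition complete_balfi :: "'a balfi \<Rightarrow> bool" where
  "complete_balfi B \<longleftrightarrow> balfi B \<and> complete_lattice (balfi_order B)"


section \<open>Structures and semantic consequence\<close>

text \<open>
  An \<open>n\<close>-ary map on the domain is a function on lists, of which only the values on
  lists of length \<open>n\<close> over the domain matter.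
\<close>

record ('u, 'a, 'c, 'f, 'p) fo_struct =
  dom :: "'u set"
  alg :: "'a balfi"
  cst_int :: "'c \<Rightarrow> 'u"
  fun_int :: "'f \<Rightarrow> 'u list \<Rightarrow> 'u"
  pred_int :: "'p \<Rightarrow> 'u list \<Rightarrow> 'a"

definition is_structure ::
    "('c, 'f, 'p) signature \<Rightarrow> ('u, 'a, 'c, 'f, 'p) fo_struct \<Rightarrow> bool" where
  "is_structure \<Omega> S \<longleftrightarrow>
     dom S \<noteq> {} \<and> complete_balfi (alg S) \<and>
     (\<forall>c\<in>sig_csts \<Omega>. cst_int S c \<in> dom S) \<and>
     (\<forall>n\<ge>1. \<forall>f\<in>sig_funs \<Omega> n. \<forall>us. length us = n \<and> set us \<subseteq> dom S \<longrightarrow> fun_int S f us \<in> dom S) \<and>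
     (\<forall>n\<ge>1. \<forall>P\<in>sig_preds \<Omega> n. \<forall>us. length us = n \<and> set us \<subseteq> dom S \<longrightarrow>
        pred_int S P us \<in> carrier (alg S))"

fun eval_tm :: "('u, 'a, 'c, 'f, 'p) fo_struct \<Rightarrow> (nat \<Rightarrow> 'u) \<Rightarrow> ('c, 'f) tm \<Rightarrow> 'u" where
  "eval_tm S \<mu> (Var x) = \<mu> x"
| "eval_tm S \<mu> (Cst c) = cst_int S c"
| "eval_tm S \<mu> (Fn f ts) = fun_int S f (map (eval_tm S \<mu>) ts)"

fun eval_fm :: "('u, 'a, 'c, 'f, 'p) fo_struct \<Rightarrow> (nat \<Rightarrow> 'u) \<Rightarrow> ('c, 'f, 'p) fm \<Rightarrow> 'a" where
  "eval_fm S \<mu> (Atom P ts) = pred_int S P (map (eval_tm S \<mu>) ts)"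
| "eval_fm S \<mu> (And \<alpha> \<beta>) = bmeet (alg S) (eval_fm S \<mu> \<alpha>) (eval_fm S \<mu> \<beta>)"
| "eval_fm S \<mu> (Or \<alpha> \<beta>) = bjoin (alg S) (eval_fm S \<mu> \<alpha>) (eval_fm S \<mu> \<beta>)"
| "eval_fm S \<mu> (Imp \<alpha> \<beta>) = bimp (alg S) (eval_fm S \<mu> \<alpha>) (eval_fm S \<mu> \<beta>)"
| "eval_fm S \<mu> (Neg \<alpha>) = bneg (alg S) (eval_fm S \<mu> \<alpha>)"
| "eval_fm S \<mu> (Circ \<alpha>) = bcirc (alg S) (eval_fm S \<mu> \<alpha>)"
| "eval_fm S \<mu> (Forall x \<alpha>) =
     infi (balfi_order (alg S)) (dom S) (\<lambda>a. eval_fm S (\<mu>(x := a)) \<alpha>)"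
| "eval_fm S \<mu> (Exists x \<alpha>) =
     supr (balfi_order (alg S)) (dom S) (\<lambda>a. eval_fm S (\<mu>(x := a)) \<alpha>)"

text \<open>
  HOL cannot quantify over types inside a formula, so ``every structure over \<open>\<Omega>\<close>'' is rendered as
  every structure whose domain is a subset of the type \<open>'u\<close> and whose BALFI has its carrier
  contained in the type \<open>'a\<close>. Both types are explicit parameters.
\<close>

definition valid ::
    "'u itself \<Rightarrow> 'a itself \<Rightarrow> ('c, 'f, 'p) signature \<Rightarrow> ('c, 'f, 'p) fm \<Rightarrow> bool" where
  "valid _ _ \<Omega> \<phi> \<longleftrightarrow>
     (\<forall>(S :: ('u, 'a, 'c, 'f, 'p) fo_struct) \<mu>.
        is_structure \<Omega> S \<and> range \<mu> \<subseteq> dom S \<longrightarrow> eval_fm S \<mu> \<phi> = bone (alg S))"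

definition RQmbC_entails ::
    "'u itself \<Rightarrow> 'a itself \<Rightarrow> ('c, 'f, 'p) signature \<Rightarrow>
     ('c, 'f, 'p) fm set \<Rightarrow> ('c, 'f, 'p) fm \<Rightarrow> bool" where
  "RQmbC_entails U A \<Omega> \<Gamma> \<phi> \<longleftrightarrow>
     valid U A \<Omega> \<phi> \<or>
     (\<exists>\<gamma>s. \<gamma>s \<noteq> [] \<and> set \<gamma>s \<subseteq> \<Gamma> \<and> valid U A \<Omega> (Imp (conj_list \<gamma>s) \<phi>))"

text \<open>
  A type pair is large enough for completeness if it has room for countable domains and for complete
  Boolean algebras of the size of the continuum, such as completions of countable ones.
  Without such a bound completeness fails (for one-element types every formula is valid).
  As completeness only uses validity as a hypothesis, completeness for one large pair
  of types already covers validity in structures of arbitrary size.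
\<close>

definition large_types :: "'u itself \<Rightarrow> 'a itself \<Rightarrow> bool" where
  "large_types _ _ \<longleftrightarrow>
     (UNIV :: nat set) \<lesssim> (UNIV :: 'u set) \<and> (UNIV :: nat set set) \<lesssim> (UNIV :: 'a set)"

end

theory Submission
  imports Defs
begin

text \<open>
  By countability, every unprovable formula is omitted by a maximal consistent set \<open>T\<close> with
  Henkin witnesses, and countably many such sets \<open>T\<^sub>n\<close> separate the formulas up to provable
  equivalence. Hence \<open>\<alpha> \<mapsto> {n. \<alpha> \<in> T\<^sub>n}\<close> embeds the Lindenbaum algebra into the complete
  Boolean algebra of sets of naturals. The embedding turns quantifiers into intersections and unions
  over all terms, so no completion has to be built. The replacement rules for \<open>\<not>\<close> and \<open>\<circ>\<close>
  make these operations well defined on the image, and they extend to all sets by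
  \<open>\<not>a = 1\<close>, \<open>\<circ>a = 0\<close>.

  If the bound variables of the sentence to be refuted lie below \<open>N\<close>, the domain consists
  of the terms with variables \<open>\<ge> N\<close>, and the witnesses are such variables. Substitution into
  subformulas then never captures, and no renaming of bound variables is needed.
\<close>

section \<open>Variables and substitution\<close>

fun bound_vars :: "('c, 'f, 'p) fm \<Rightarrow> nat set" where
  "bound_vars (Atom P ts) = {}"
| "bound_vars (And \<alpha> \<beta>) = bound_vars \<alpha> \<union> bound_vars \<beta>"
| "bound_vars (Or \<alpha> \<beta>) = bound_vars \<alpha> \<union> bound_vars \<beta>"
| "bound_vars (Imp \<alpha> \<beta>) = bound_vars \<alpha> \<union> bound_vars \<beta>"
| "bound_vars (Neg \<alpha>) = bound_vars \<alpha>"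
| "bound_vars (Circ \<alpha>) = bound_vars \<alpha>"
| "bound_vars (Forall x \<alpha>) = insert x (bound_vars \<alpha>)"
| "bound_vars (Exists x \<alpha>) = insert x (bound_vars \<alpha>)"

lemma finite_vars_tm: "finite (vars_tm t)"
  by (induction t) auto

lemma finite_free_vars: "finite (free_vars \<phi>)"
  by (induction \<phi>) (auto simp: finite_vars_tm)

lemma finite_bound_vars: "finite (bound_vars \<phi>)"
  by (induction \<phi>) auto

lemma free_forI: "bound_vars \<phi> \<inter> vars_tm t = {} \<Longrightarrow> free_for x t \<phi>"
  by (induction \<phi>) auto

lemma wf_subst_tm: "wf_term \<Omega> t \<Longrightarrow> wf_term \<Omega> s \<Longrightarrow> wf_term \<Omega> (subst_tm x t s)"
  by (induction s) auto

lemma wf_subst: "wf_term \<Omega> t \<Longrightarrow> wf_form \<Omega> \<phi> \<Longrightarrow> wf_form \<Omega> (subst x t \<phi>)"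
  by (induction \<phi>) (auto simp: wf_subst_tm)

lemma subst_tm_fresh_inverse:
  "w \<notin> vars_tm s \<Longrightarrow> subst_tm w (Var x) (subst_tm x (Var w) s) = s"
  by (induction s) (auto intro: map_idI)

lemma subst_fresh: "w \<notin> free_vars \<phi> \<Longrightarrow> subst w t \<phi> = \<phi>"
proof -
  have tm: "w \<notin> vars_tm s \<Longrightarrow> subst_tm w t s = s" for s :: "('a, 'b) tm"
    by (induction s) (auto intro: map_idI)
  show "w \<notin> free_vars \<phi> \<Longrightarrow> subst w t \<phi> = \<phi>"
    by (induction \<phi>) (auto intro!: map_idI simp: tm)
qed

text \<open>Since \<open>w\<close> does not occur in \<phi>, it appears exactly where
  \<open>x\<close> was free, and the way back restores \<phi>. At a quantifier over \<open>x\<close>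
  the first substitution stops, and the second changes nothing because \<open>w\<close> is not free
  below it.\<close>

lemma subst_fresh_inverse:
  "w \<notin> free_vars \<phi> \<union> bound_vars \<phi> \<Longrightarrow> subst w (Var x) (subst x (Var w) \<phi>) = \<phi>"
proof (induction \<phi>)
  case (Forall y \<phi>)
  then show ?case by (cases "y = x") (auto simp: subst_fresh)
next
  case (Exists y \<phi>)
  then show ?case by (cases "y = x") (auto simp: subst_fresh)
qed (auto intro!: map_idI simp: subst_tm_fresh_inverse)

text \<open>Free occurrences of \<open>w\<close> stand where \<open>x\<close> was free, hence
  outside the scope of every quantifier over \<open>x\<close>.\<close>

lemma free_for_subst_fresh:
  "w \<notin> free_vars \<phi> \<union> bound_vars \<phi> \<Longrightarrow> free_for w (Var x) (subst x (Var w) \<phi>)"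
  by (induction \<phi>) auto

lemma free_vars_subst_fresh: "x \<noteq> w \<Longrightarrow> x \<notin> free_vars (subst x (Var w) \<phi>)"
proof -
  assume "x \<noteq> w"
  then have tm: "x \<notin> vars_tm (subst_tm x (Var w) s)" for s :: "('a, 'b) tm"
    by (induction s) auto
  show ?thesis using \<open>x \<noteq> w\<close> by (induction \<phi>) (auto simp: tm)
qed

section \<open>Simultaneous substitution\<close>

fun psubst_tm :: "(nat \<Rightarrow> ('c, 'f) tm) \<Rightarrow> ('c, 'f) tm \<Rightarrow> ('c, 'f) tm" where
  "psubst_tm \<sigma> (Var x) = \<sigma> x"
| "psubst_tm \<sigma> (Cst c) = Cst c"
| "psubst_tm \<sigma> (Fn f ts) = Fn f (map (psubst_tm \<sigma>) ts)"

text \<open>Like \<open>subst\<close>, this does not rename bound variables; it is only used where no capture occurs.\<close>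

fun psubst :: "(nat \<Rightarrow> ('c, 'f) tm) \<Rightarrow> ('c, 'f, 'p) fm \<Rightarrow> ('c, 'f, 'p) fm" where
  "psubst \<sigma> (Atom P ts) = Atom P (map (psubst_tm \<sigma>) ts)"
| "psubst \<sigma> (And \<alpha> \<beta>) = And (psubst \<sigma> \<alpha>) (psubst \<sigma> \<beta>)"
| "psubst \<sigma> (Or \<alpha> \<beta>) = Or (psubst \<sigma> \<alpha>) (psubst \<sigma> \<beta>)"
| "psubst \<sigma> (Imp \<alpha> \<beta>) = Imp (psubst \<sigma> \<alpha>) (psubst \<sigma> \<beta>)"
| "psubst \<sigma> (Neg \<alpha>) = Neg (psubst \<sigma> \<alpha>)"
| "psubst \<sigma> (Circ \<alpha>) = Circ (psubst \<sigma> \<alpha>)"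
| "psubst \<sigma> (Forall x \<alpha>) = Forall x (psubst (\<sigma>(x := Var x)) \<alpha>)"
| "psubst \<sigma> (Exists x \<alpha>) = Exists x (psubst (\<sigma>(x := Var x)) \<alpha>)"

lemma psubst_tm_closed: "\<forall>x\<in>vars_tm s. \<sigma> x = Var x \<Longrightarrow> psubst_tm \<sigma> s = s"
  by (induction s) (auto intro: map_idI)

lemma psubst_closed: "\<forall>x\<in>free_vars \<phi>. \<sigma> x = Var x \<Longrightarrow> psubst \<sigma> \<phi> = \<phi>"
  by (induction \<phi> arbitrary: \<sigma>) (auto intro!: map_idI psubst_tm_closed)

lemma wf_psubst_tm: "\<forall>x. wf_term \<Omega> (\<sigma> x) \<Longrightarrow> wf_term \<Omega> s \<Longrightarrow> wf_term \<Omega> (psubst_tm \<sigma> s)"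
  by (induction s) auto

lemma wf_psubst: "\<forall>x. wf_term \<Omega> (\<sigma> x) \<Longrightarrow> wf_form \<Omega> \<phi> \<Longrightarrow> wf_form \<Omega> (psubst \<sigma> \<phi>)"
  by (induction \<phi> arbitrary: \<sigma>) (auto simp: wf_psubst_tm)

lemma bound_vars_psubst: "bound_vars (psubst \<sigma> \<phi>) = bound_vars \<phi>"
  by (induction \<phi> arbitrary: \<sigma>) auto

lemma subst_tm_psubst_tm:
  assumes "\<sigma> x = Var x" "\<forall>y. y \<noteq> x \<longrightarrow> x \<notin> vars_tm (\<sigma> y)"
  shows "subst_tm x t (psubst_tm \<sigma> s) = psubst_tm (\<sigma>(x := t)) s"
proof (induction s)
  case (Var y)
  have "x \<notin> vars_tm r \<Longrightarrow> subst_tm x t r = r" for r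
    by (induction r) (auto intro: map_idI)
  then show ?case using assms by auto
qed auto

text \<open>By hypothesis \<open>x\<close> enters \<open>psubst \<sigma> \<phi>\<close> only from
  \<open>x\<close> itself, so substituting for it afterwards amounts to changing \<sigma> at
  \<open>x\<close>. The identity is purely syntactic: capture is treated alike on both
  sides.\<close>

lemma subst_psubst:
  assumes "\<sigma> x = Var x" "\<forall>y. y \<noteq> x \<longrightarrow> x \<notin> vars_tm (\<sigma> y)"
  shows "subst x t (psubst \<sigma> \<phi>) = psubst (\<sigma>(x := t)) \<phi>"
  using assms
proof (induction \<phi> arbitrary: \<sigma>)
  case (Forall y \<phi>)
  show ?case
  proof (cases "y = x")
    case False
    \<comment> \<open>Below the quantifier \<sigma> is reset at \<open>y\<close> to
      \<open>Var y\<close>, which does not contain \<open>x\<close>, so the hypotheses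
      persist.\<close>
    then have "subst x t (psubst (\<sigma>(y := Var y)) \<phi>) = psubst (\<sigma>(y := Var y, x := t)) \<phi>"
      using Forall.prems by (intro Forall.IH) auto
    also have "\<sigma>(y := Var y, x := t) = \<sigma>(x := t, y := Var y)"
      using False by (rule fun_upd_twist)
    finally show ?thesis using False by (simp only: psubst.simps subst.simps if_False)
  qed (simp add: fun_upd_def cong: if_cong)
next
  case (Exists y \<phi>)
  show ?case
  proof (cases "y = x")
    case False
    then have "subst x t (psubst (\<sigma>(y := Var y)) \<phi>) = psubst (\<sigma>(y := Var y, x := t)) \<phi>"
      using Exists.prems by (intro Exists.IH) auto
    also have "\<sigma>(y := Var y, x := t) = \<sigma>(x := t, y := Var y)"
      using False by (rule fun_upd_twist)
    finally show ?thesis using False by (simp only: psubst.simps subst.simps if_False)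
  qed (simp add: fun_upd_def cong: if_cong)
qed (auto simp: subst_tm_psubst_tm)


section \<open>Countability of the language\<close>

instance tm :: (countable, countable) countable
  by countable_datatype

instance fm :: (countable, countable, countable) countable
  by countable_datatype

text \<open>The symbol types may be uncountable; countability of the language rests on the symbols
  of \<Omega> alone.\<close>

lemma wf_term_symbols:
  "wf_term \<Omega> t \<Longrightarrow> set1_tm t \<subseteq> sig_csts \<Omega> \<and> set2_tm t \<subseteq> (\<Union>n\<in>{1..}. sig_funs \<Omega> n)"
  by (induction t) force+

lemma wf_form_symbols:
  "wf_form \<Omega> \<phi> \<Longrightarrow> set1_fm \<phi> \<subseteq> sig_csts \<Omega> \<and> set2_fm \<phi> \<subseteq> (\<Union>n\<in>{1..}. sig_funs \<Omega> n) \<and>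
     set3_fm \<phi> \<subseteq> (\<Union>n\<in>{1..}. sig_preds \<Omega> n)"
proof (induction \<phi>)
  case (Atom P ts)
  then have "\<forall>t\<in>set ts. set1_tm t \<subseteq> sig_csts \<Omega> \<and> set2_tm t \<subseteq> (\<Union>n\<in>{1..}. sig_funs \<Omega> n)"
    using wf_term_symbols by (metis wf_form.simps(1))
  moreover have "P \<in> (\<Union>n\<in>{1..}. sig_preds \<Omega> n)"
    using Atom by auto
  ultimately show ?case by (simp add: UN_subset_iff)
qed auto

text \<open>Numbering the symbols by \<open>to_nat_on\<close> turns well-formed syntax into syntax
  over \<open>nat\<close>, a countable type by the instances above. The numbering is known to be
  injective on the symbols of \<Omega> only, hence the strong injectivity rules of the map
  functions.\<close>

lemma
  assumes "is_signature \<Omega>"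
  shows countable_wf_terms: "countable {t. wf_term \<Omega> t}"
    and countable_For1: "countable (For1 \<Omega>)"
proof -
  define C F P where "C = sig_csts \<Omega>" and "F = (\<Union>n\<in>{1..}. sig_funs \<Omega> n)"
    and "P = (\<Union>n\<in>{1..}. sig_preds \<Omega> n)"
  have cnt: "countable C" "countable F" "countable P"
    using assms by (auto simp: is_signature_def C_def F_def P_def)
  have "inj_on (map_tm (to_nat_on C) (to_nat_on F)) {t. wf_term \<Omega> t}"
  proof (rule inj_onI)
    fix s t assume "s \<in> {t. wf_term \<Omega> t}" "t \<in> {t. wf_term \<Omega> t}"
    then have "set1_tm s \<subseteq> C" "set2_tm s \<subseteq> F" "set1_tm t \<subseteq> C" "set2_tm t \<subseteq> F"
      using wf_term_symbols unfolding C_def F_def by blast+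
    then show "s = t" if "map_tm (to_nat_on C) (to_nat_on F) s = map_tm (to_nat_on C) (to_nat_on F) t"
      using that by (elim tm.inj_map_strong[rotated 2])
        (meson cnt subsetD to_nat_on_inj)+
  qed
  then show "countable {t. wf_term \<Omega> t}"
    by (rule countableI')
  have "inj_on (map_fm (to_nat_on C) (to_nat_on F) (to_nat_on P)) (For1 \<Omega>)"
  proof (rule inj_onI)
    fix \<phi> \<psi> assume "\<phi> \<in> For1 \<Omega>" "\<psi> \<in> For1 \<Omega>"
    then have "set1_fm \<phi> \<subseteq> C" "set2_fm \<phi> \<subseteq> F" "set3_fm \<phi> \<subseteq> P"
      "set1_fm \<psi> \<subseteq> C" "set2_fm \<psi> \<subseteq> F" "set3_fm \<psi> \<subseteq> P"
      using wf_form_symbols unfolding C_def F_def P_def For1_def by blast+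
    then show "\<phi> = \<psi>" if "map_fm (to_nat_on C) (to_nat_on F) (to_nat_on P) \<phi> =
        map_fm (to_nat_on C) (to_nat_on F) (to_nat_on P) \<psi>"
      using that by (elim fm.inj_map_strong[rotated 3])
        (meson cnt subsetD to_nat_on_inj)+
  qed
  then show "countable (For1 \<Omega>)"
    by (rule countableI')
qed


section \<open>Derived rules of the calculus\<close>

lemma infers_mono: "RQmbC_infers X \<psi> \<Longrightarrow> X \<subseteq> Y \<Longrightarrow> RQmbC_infers Y \<psi>"
  by (induction rule: RQmbC_infers.induct) (auto intro: RQmbC_infers.intros)

lemma derivation_append:
  assumes "derivation \<Omega> \<delta>s" "derivation \<Omega> \<epsilon>s"
  shows "derivation \<Omega> (\<delta>s @ \<epsilon>s)"
  unfolding derivation_def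
proof (intro allI impI)
  fix i assume i: "i < length (\<delta>s @ \<epsilon>s)"
  show "(\<delta>s @ \<epsilon>s) ! i \<in> For1 \<Omega> \<and> ((\<delta>s @ \<epsilon>s) ! i \<in> RQmbC_axioms \<Omega> \<or>
    RQmbC_infers (set (take i (\<delta>s @ \<epsilon>s))) ((\<delta>s @ \<epsilon>s) ! i))"
  proof (cases "i < length \<delta>s")
    case True
    then show ?thesis using assms(1) by (simp add: derivation_def nth_append)
  next
    case False
    define k where "k = i - length \<delta>s"
    have k: "k < length \<epsilon>s" "(\<delta>s @ \<epsilon>s) ! i = \<epsilon>s ! k"
      "set (take k \<epsilon>s) \<subseteq> set (take i (\<delta>s @ \<epsilon>s))"
      using False i by (auto simp: k_def nth_append)
    then show ?thesis using assms(2) infers_mono[OF _ k(3)] unfolding derivation_def by metis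
  qed
qed

lemma derivation_snoc:
  assumes "derivation \<Omega> \<delta>s" "wf_form \<Omega> \<psi>" "\<psi> \<in> RQmbC_axioms \<Omega> \<or> RQmbC_infers (set \<delta>s) \<psi>"
  shows "derivation \<Omega> (\<delta>s @ [\<psi>])"
  using assms by (auto simp: derivation_def nth_append less_Suc_eq For1_def)

lemma provable_axiom: "\<phi> \<in> RQmbC_axioms \<Omega> \<Longrightarrow> wf_form \<Omega> \<phi> \<Longrightarrow> provable \<Omega> \<phi>"
  unfolding provable_def by (rule exI[of _ "[\<phi>]"]) (simp add: derivation_def For1_def)

lemma provable_wf: "provable \<Omega> \<phi> \<Longrightarrow> wf_form \<Omega> \<phi>"
proof -
  assume "provable \<Omega> \<phi>"
  then obtain \<delta>s where "derivation \<Omega> \<delta>s" "\<delta>s \<noteq> []" "last \<delta>s = \<phi>"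
    unfolding provable_def by blast
  then have "\<delta>s ! (length \<delta>s - 1) \<in> For1 \<Omega>" "\<delta>s ! (length \<delta>s - 1) = \<phi>"
    by (auto simp: derivation_def last_conv_nth)
  then show ?thesis by (simp add: For1_def)
qed

text \<open>Two derivations placed one after the other contain both premises. Rules with a single
  premise are the case \<alpha> = \<beta>.\<close>

lemma provable_infers:
  assumes "RQmbC_infers {\<alpha>, \<beta>} \<psi>" "provable \<Omega> \<alpha>" "provable \<Omega> \<beta>" "wf_form \<Omega> \<psi>"
  shows "provable \<Omega> \<psi>"
proof -
  obtain \<delta>s where \<delta>: "derivation \<Omega> \<delta>s" "\<delta>s \<noteq> []" "last \<delta>s = \<alpha>"
    using assms(2) unfolding provable_def by blast
  obtain \<epsilon>s where \<epsilon>: "derivation \<Omega> \<epsilon>s" "\<epsilon>s \<noteq> []" "last \<epsilon>s = \<beta>"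
    using assms(3) unfolding provable_def by blast
  have "{\<alpha>, \<beta>} \<subseteq> set (\<delta>s @ \<epsilon>s)"
    using last_in_set[OF \<delta>(2)] last_in_set[OF \<epsilon>(2)] \<delta>(3) \<epsilon>(3) by simp
  then have "derivation \<Omega> ((\<delta>s @ \<epsilon>s) @ [\<psi>])"
    using assms \<delta> \<epsilon> by (intro derivation_snoc derivation_append disjI2 infers_mono[OF assms(1)])
  then show ?thesis unfolding provable_def
    by (intro exI[of _ "(\<delta>s @ \<epsilon>s) @ [\<psi>]"]) simp
qed

lemma provable_MP:
  assumes "provable \<Omega> (Imp \<alpha> \<beta>)" "provable \<Omega> \<alpha>" shows "provable \<Omega> \<beta>"
  using provable_wf[OF assms(1)]
  by (intro provable_infers[OF _ assms] RQmbC_infers.MP[of \<alpha>]) auto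

lemma provable_Iff_Neg: "provable \<Omega> (Iff \<alpha> \<beta>) \<Longrightarrow> provable \<Omega> (Iff (Neg \<alpha>) (Neg \<beta>))"
  by (frule provable_wf, rule provable_infers[of "Iff \<alpha> \<beta>" "Iff \<alpha> \<beta>"])
    (auto intro: RQmbC_infers.RNeg)

lemma provable_Iff_Circ: "provable \<Omega> (Iff \<alpha> \<beta>) \<Longrightarrow> provable \<Omega> (Iff (Circ \<alpha>) (Circ \<beta>))"
  by (frule provable_wf, rule provable_infers[of "Iff \<alpha> \<beta>" "Iff \<alpha> \<beta>"])
    (auto intro: RQmbC_infers.RCirc)

lemma provable_ExIn:
  "provable \<Omega> (Imp \<phi> \<psi>) \<Longrightarrow> x \<notin> free_vars \<psi> \<Longrightarrow> provable \<Omega> (Imp (Exists x \<phi>) \<psi>)"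
  by (frule provable_wf, rule provable_infers[of "Imp \<phi> \<psi>" "Imp \<phi> \<psi>"])
    (auto intro: RQmbC_infers.ExIn)

lemma provable_AllIn:
  "provable \<Omega> (Imp \<phi> \<psi>) \<Longrightarrow> x \<notin> free_vars \<phi> \<Longrightarrow> provable \<Omega> (Imp \<phi> (Forall x \<psi>))"
  by (frule provable_wf, rule provable_infers[of "Imp \<phi> \<psi>" "Imp \<phi> \<psi>"])
    (auto intro: RQmbC_infers.AllIn)

section \<open>Propositional reasoning behind an antecedent\<close>

lemma Imp_MP:
  assumes "provable \<Omega> (Imp \<chi> (Imp \<alpha> \<beta>))" "provable \<Omega> (Imp \<chi> \<alpha>)"
  shows "provable \<Omega> (Imp \<chi> \<beta>)"
proof -
  have "provable \<Omega> (Imp (Imp \<chi> (Imp \<alpha> \<beta>)) (Imp (Imp \<chi> \<alpha>) (Imp \<chi> \<beta>)))"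
    using provable_wf[OF assms(1)] by (intro provable_axiom RQmbC_axioms.Ax2) auto
  then show ?thesis by (rule provable_MP[OF provable_MP[OF _ assms(1)] assms(2)])
qed

lemma Imp_const:
  assumes "provable \<Omega> \<alpha>" "wf_form \<Omega> \<chi>" shows "provable \<Omega> (Imp \<chi> \<alpha>)"
proof -
  have "provable \<Omega> (Imp \<alpha> (Imp \<chi> \<alpha>))"
    using assms provable_wf[OF assms(1)] by (intro provable_axiom RQmbC_axioms.Ax1) auto
  then show ?thesis using assms(1) by (rule provable_MP)
qed

lemma Imp_axiom:
  "\<alpha> \<in> RQmbC_axioms \<Omega> \<Longrightarrow> wf_form \<Omega> \<alpha> \<Longrightarrow> wf_form \<Omega> \<chi> \<Longrightarrow> provable \<Omega> (Imp \<chi> \<alpha>)"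
  by (simp add: Imp_const provable_axiom)

lemma Imp_trans:
  assumes "provable \<Omega> (Imp \<alpha> \<beta>)" "provable \<Omega> (Imp \<beta> \<gamma>)"
  shows "provable \<Omega> (Imp \<alpha> \<gamma>)"
proof -
  have "wf_form \<Omega> \<alpha>" using provable_wf[OF assms(1)] by simp
  then show ?thesis using Imp_MP[OF Imp_const[OF assms(2)] assms(1)] by simp
qed

lemma Imp_refl: assumes "wf_form \<Omega> \<alpha>" shows "provable \<Omega> (Imp \<alpha> \<alpha>)"
proof (rule Imp_MP)
  show "provable \<Omega> (Imp \<alpha> (Imp (Imp \<alpha> \<alpha>) \<alpha>))" "provable \<Omega> (Imp \<alpha> (Imp \<alpha> \<alpha>))"
    using assms by (auto intro!: provable_axiom RQmbC_axioms.Ax1)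
qed

lemma And_left: "wf_form \<Omega> \<alpha> \<Longrightarrow> wf_form \<Omega> \<beta> \<Longrightarrow> provable \<Omega> (Imp (And \<alpha> \<beta>) \<alpha>)"
  by (intro provable_axiom RQmbC_axioms.Ax4) auto

lemma And_right: "wf_form \<Omega> \<alpha> \<Longrightarrow> wf_form \<Omega> \<beta> \<Longrightarrow> provable \<Omega> (Imp (And \<alpha> \<beta>) \<beta>)"
  by (intro provable_axiom RQmbC_axioms.Ax5) auto

text \<open>Ax3 yields the conjunction behind the antecedents \<chi> and \<psi>, and Ax2, itself
  placed behind \<chi>, distributes \<psi> over the given implication. Together with
  \<open>Imp_MP\<close> this does the work of a deduction theorem, hypotheses being kept as
  antecedents of theorems.\<close>

lemma Imp_curry:
  assumes "provable \<Omega> (Imp (And \<chi> \<psi>) \<beta>)"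
  shows "provable \<Omega> (Imp \<chi> (Imp \<psi> \<beta>))"
proof -
  have wf: "wf_form \<Omega> \<chi>" "wf_form \<Omega> \<psi>" "wf_form \<Omega> \<beta>" using provable_wf[OF assms] by auto
  have "provable \<Omega> (Imp \<chi> (Imp \<psi> (Imp (And \<chi> \<psi>) \<beta>)))"
    by (rule Imp_const[OF Imp_const[OF assms]]) (use wf in auto)
  then have "provable \<Omega> (Imp \<chi> (Imp (Imp \<psi> (And \<chi> \<psi>)) (Imp \<psi> \<beta>)))"
    by (rule Imp_MP[rotated]) (rule Imp_axiom[OF RQmbC_axioms.Ax2], use wf in auto)
  moreover have "provable \<Omega> (Imp \<chi> (Imp \<psi> (And \<chi> \<psi>)))"
    using wf by (intro provable_axiom RQmbC_axioms.Ax3) auto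
  ultimately show ?thesis by (rule Imp_MP)
qed

lemma Imp_swap:
  assumes "provable \<Omega> (Imp \<chi> (Imp \<psi> \<beta>))"
  shows "provable \<Omega> (Imp \<psi> (Imp \<chi> \<beta>))"
proof -
  have wf: "wf_form \<Omega> \<chi>" "wf_form \<Omega> \<psi>" using provable_wf[OF assms] by auto
  have "provable \<Omega> (Imp (And \<psi> \<chi>) (Imp \<psi> \<beta>))"
    by (rule Imp_trans[OF And_right assms]) (use wf in auto)
  then have "provable \<Omega> (Imp (And \<psi> \<chi>) \<beta>)"
    by (rule Imp_MP[OF _ And_left]) (use wf in auto)
  then show ?thesis by (rule Imp_curry)
qed

text \<open>Generalisation over the fresh \<open>w\<close>, followed by a renaming: instantiating
  \<open>w\<close> by \<open>x\<close> gives back \<phi>, and generalising over \<open>x\<close>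
  then gives \<open>Forall x \<phi>\<close>.\<close>

lemma Imp_Forall_subst_fresh:
  assumes "provable \<Omega> (Imp \<chi> (subst x (Var w) \<phi>))" "wf_form \<Omega> \<phi>"
    and "w \<notin> free_vars \<chi>" "w \<notin> free_vars \<phi> \<union> bound_vars \<phi>"
  shows "provable \<Omega> (Imp \<chi> (Forall x \<phi>))"
proof -
  let ?\<psi> = "subst x (Var w) \<phi>"
  have "provable \<Omega> (Imp (Forall w ?\<psi>) (subst w (Var x) ?\<psi>))"
    using assms by (intro provable_axiom RQmbC_axioms.AxAll)
      (auto simp: wf_subst free_for_subst_fresh)
  then have "provable \<Omega> (Imp (Forall w ?\<psi>) \<phi>)"
    using subst_fresh_inverse[OF assms(4), of x] by simp
  \<comment> \<open>The variable \<open>x\<close> is not free in the antecedent: if \<open>x\<close>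
    differs from \<open>w\<close> it was substituted away, otherwise it is bound.\<close>
  then have "provable \<Omega> (Imp (Forall w ?\<psi>) (Forall x \<phi>))"
    by (rule provable_AllIn) (use free_vars_subst_fresh[of x w \<phi>] in auto)
  then show ?thesis by (rule Imp_trans[OF provable_AllIn[OF assms(1,3)]])
qed

lemma Imp_Exists_subst_fresh:
  assumes "provable \<Omega> (Imp (subst x (Var w) \<phi>) \<chi>)" "wf_form \<Omega> \<phi>"
    and "w \<notin> free_vars \<chi>" "w \<notin> free_vars \<phi> \<union> bound_vars \<phi>"
  shows "provable \<Omega> (Imp (Exists x \<phi>) \<chi>)"
proof -
  let ?\<psi> = "subst x (Var w) \<phi>"
  have "provable \<Omega> (Imp (subst w (Var x) ?\<psi>) (Exists w ?\<psi>))"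
    using assms by (intro provable_axiom RQmbC_axioms.AxEx)
      (auto simp: wf_subst free_for_subst_fresh)
  then have "provable \<Omega> (Imp \<phi> (Exists w ?\<psi>))"
    using subst_fresh_inverse[OF assms(4), of x] by simp
  then have "provable \<Omega> (Imp (Exists x \<phi>) (Exists w ?\<psi>))"
    by (rule provable_ExIn) (use free_vars_subst_fresh[of x w \<phi>] in auto)
  then show ?thesis by (rule Imp_trans[OF _ provable_ExIn[OF assms(1,3)]])
qed


text \<open>The language has no constant for falsity, and \<open>Neg\<close> is paraconsistent. Any
  formula that implies all others serves as falsum, and \<open>Imp \<alpha> bot\<close> then acts as
  classical negation.\<close>

locale RQmbC_falsum =
  fixes \<Omega> :: "('c, 'f, 'p) signature" and bot :: "('c, 'f, 'p) fm"
  assumes wf_bot: "wf_form \<Omega> bot"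
    and bot_elim: "wf_form \<Omega> \<beta> \<Longrightarrow> provable \<Omega> (Imp bot \<beta>)"

text \<open>The conjuncts are the three antecedents of bc1, which together are explosive.\<close>

lemma RQmbC_falsum_bc1:
  assumes "wf_form \<Omega> \<kappa>"
  shows "RQmbC_falsum \<Omega> (And (Circ \<kappa>) (And \<kappa> (Neg \<kappa>)))" (is "RQmbC_falsum \<Omega> ?bot")
proof
  show "wf_form \<Omega> ?bot" using assms by simp
  fix \<beta> assume \<beta>: "wf_form \<Omega> \<beta>"
  have circ: "provable \<Omega> (Imp ?bot (Circ \<kappa>))" and both: "provable \<Omega> (Imp ?bot (And \<kappa> (Neg \<kappa>)))"
    using assms by (simp_all add: And_left And_right)
  have pos: "provable \<Omega> (Imp ?bot \<kappa>)" and neg: "provable \<Omega> (Imp ?bot (Neg \<kappa>))"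
    using assms by (auto intro: Imp_trans[OF both And_left] Imp_trans[OF both And_right])
  have "provable \<Omega> (Imp ?bot (Imp (Circ \<kappa>) (Imp \<kappa> (Imp (Neg \<kappa>) \<beta>))))"
    using assms \<beta> by (intro Imp_axiom RQmbC_axioms.bc1) auto
  then show "provable \<Omega> (Imp ?bot \<beta>)"
    by (rule Imp_MP[OF Imp_MP[OF Imp_MP[OF _ circ] pos] neg])
qed


section \<open>Henkin sets\<close>

context RQmbC_falsum
begin

text \<open>Reductio by cases on Ax9, whose instance \<open>Or (Imp \<alpha> bot) \<alpha>\<close>
  is excluded middle for classical negation. In the first case \<chi> leads to \<open>bot\<close>
  and thus to \<alpha>.\<close>

lemma Imp_classical:
  assumes "provable \<Omega> (Imp (And \<chi> (Imp \<alpha> bot)) bot)"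
  shows "provable \<Omega> (Imp \<chi> \<alpha>)"
proof -
  have wf: "wf_form \<Omega> \<chi>" "wf_form \<Omega> \<alpha>" using provable_wf[OF assms] by auto
  have neg: "provable \<Omega> (Imp \<chi> (Imp (Imp \<alpha> bot) \<alpha>))"
    using wf by (intro Imp_curry Imp_trans[OF assms] bot_elim)
  have refl: "provable \<Omega> (Imp \<chi> (Imp \<alpha> \<alpha>))"
    using wf by (rule Imp_const[OF Imp_refl, rotated])
  have em: "provable \<Omega> (Imp \<chi> (Or (Imp \<alpha> bot) \<alpha>))"
    using wf wf_bot by (intro Imp_axiom RQmbC_axioms.Ax9) auto
  have "provable \<Omega> (Imp \<chi> (Imp (Imp (Imp \<alpha> bot) \<alpha>) (Imp (Imp \<alpha> \<alpha>) (Imp (Or (Imp \<alpha> bot) \<alpha>) \<alpha>))))"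
    using wf wf_bot by (intro Imp_axiom RQmbC_axioms.Ax8) auto
  then show ?thesis
    by (rule Imp_MP[OF Imp_MP[OF Imp_MP[OF _ neg] refl] em])
qed

text \<open>Describes a stage \<chi> of the Henkin construction after \<psi> has been treated. Both
  quantifiers are primitive, so accepted existentials and refuted universals each receive a
  witness.\<close>

definition decides :: "nat \<Rightarrow> ('c, 'f, 'p) fm \<Rightarrow> ('c, 'f, 'p) fm \<Rightarrow> bool" where
  "decides N \<psi> \<chi> \<longleftrightarrow>
     provable \<Omega> (Imp \<chi> \<psi>) \<and>
       (\<forall>x \<phi>. \<psi> = Exists x \<phi> \<longrightarrow>
         (\<exists>w\<ge>N. provable \<Omega> (Imp \<chi> (subst x (Var w) \<phi>)))) \<or>
     provable \<Omega> (Imp \<chi> (Imp \<psi> bot)) \<and>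
       (\<forall>x \<phi>. \<psi> = Forall x \<phi> \<longrightarrow>
         (\<exists>w\<ge>N. provable \<Omega> (Imp \<chi> (Imp (subst x (Var w) \<phi>) bot))))"

text \<open>A stage is a single formula and mentions finitely many variables, so variables can serve
  as witnesses in place of new constants.\<close>

lemma ex_fresh_variable:
  fixes \<phi> \<chi> :: "('c, 'f, 'p) fm"
  shows "\<exists>w\<ge>N. w \<notin> free_vars \<chi> \<and> w \<notin> free_vars \<phi> \<union> bound_vars \<phi>"
proof -
  have "finite ({..<N} \<union> free_vars \<chi> \<union> free_vars \<phi> \<union> bound_vars \<phi>)"
    by (simp add: finite_free_vars finite_bound_vars)
  then obtain w where "w \<notin> {..<N} \<union> free_vars \<chi> \<union> free_vars \<phi> \<union> bound_vars \<phi>"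
    using ex_new_if_finite[OF infinite_UNIV_nat] by metis
  then show ?thesis by (intro exI[of _ w]) simp
qed

text \<open>If the witness instance led to \<open>bot\<close>, the freshness of \<open>w\<close>
  would let \<open>Exists x \<phi>\<close> do the same, and that formula is already a conjunct.
  Freshness extends to \<open>bot\<close>, which occurs in the consequent when the existential rule
  is applied.\<close>

lemma consistent_add_Exists_witness:
  assumes con: "\<not> provable \<Omega> (Imp (And \<chi> (Exists x \<phi>)) bot)"
    and wf: "wf_form \<Omega> \<chi>" "wf_form \<Omega> \<phi>"
    and fresh: "w \<notin> free_vars (Imp (And \<chi> (Exists x \<phi>)) bot)" "w \<notin> free_vars \<phi> \<union> bound_vars \<phi>"
  shows "\<not> provable \<Omega> (Imp (And (And \<chi> (Exists x \<phi>)) (subst x (Var w) \<phi>)) bot)"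
proof
  let ?\<chi> = "And \<chi> (Exists x \<phi>)"
  assume "provable \<Omega> (Imp (And ?\<chi> (subst x (Var w) \<phi>)) bot)"
  then have "provable \<Omega> (Imp (subst x (Var w) \<phi>) (Imp ?\<chi> bot))"
    by (rule Imp_swap[OF Imp_curry])
  then have "provable \<Omega> (Imp (Exists x \<phi>) (Imp ?\<chi> bot))"
    by (rule Imp_Exists_subst_fresh[OF _ wf(2) fresh])
  then have "provable \<Omega> (Imp ?\<chi> (Imp ?\<chi> bot))"
    by (rule Imp_trans[OF And_right, rotated 2]) (use wf in simp_all)
  then have "provable \<Omega> (Imp ?\<chi> bot)"
    by (rule Imp_MP[OF _ Imp_refl]) (use wf in simp)
  then show False using con by blast
qed

text \<open>By reductio an inconsistency would prove the instance at \<open>w\<close>; as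
  \<open>w\<close> is fresh, this generalises to \<open>Forall x \<phi>\<close>, whose classical
  negation is a conjunct.\<close>

lemma consistent_add_Forall_witness:
  assumes con: "\<not> provable \<Omega> (Imp (And \<chi> (Imp (Forall x \<phi>) bot)) bot)"
    and wf: "wf_form \<Omega> \<chi>" "wf_form \<Omega> \<phi>"
    and fresh: "w \<notin> free_vars (And \<chi> (Imp (Forall x \<phi>) bot))" "w \<notin> free_vars \<phi> \<union> bound_vars \<phi>"
  shows "\<not> provable \<Omega>
    (Imp (And (And \<chi> (Imp (Forall x \<phi>) bot)) (Imp (subst x (Var w) \<phi>) bot)) bot)"
proof
  let ?\<chi> = "And \<chi> (Imp (Forall x \<phi>) bot)"
  assume "provable \<Omega> (Imp (And ?\<chi> (Imp (subst x (Var w) \<phi>) bot)) bot)"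
  then have "provable \<Omega> (Imp ?\<chi> (subst x (Var w) \<phi>))"
    by (rule Imp_classical)
  then have "provable \<Omega> (Imp ?\<chi> (Forall x \<phi>))"
    by (rule Imp_Forall_subst_fresh[OF _ wf(2) fresh])
  moreover have "provable \<Omega> (Imp ?\<chi> (Imp (Forall x \<phi>) bot))"
    using wf wf_bot by (simp add: And_right)
  ultimately have "provable \<Omega> (Imp ?\<chi> bot)" by (rule Imp_MP[rotated])
  then show False using con by blast
qed

text \<open>The formula \<psi> is added if this is consistent, otherwise its classical negation; the
  witness lemmas then supply an instance where one is due.\<close>

lemma consistent_extend:
  assumes con: "\<not> provable \<Omega> (Imp \<chi> bot)" and wf: "wf_form \<Omega> \<chi>" "wf_form \<Omega> \<psi>"
  shows "\<exists>\<chi>'. wf_form \<Omega> \<chi>' \<and> \<not> provable \<Omega> (Imp \<chi>' bot) \<and> provable \<Omega> (Imp \<chi>' \<chi>) \<and> decides N \<psi> \<chi>'"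
proof (cases "provable \<Omega> (Imp (And \<chi> \<psi>) bot)")
  case con': False
  have left: "provable \<Omega> (Imp (And \<chi> \<psi>) \<chi>)" and right: "provable \<Omega> (Imp (And \<chi> \<psi>) \<psi>)"
    using wf by (auto intro: And_left And_right)
  show ?thesis
  proof (cases "\<exists>x \<phi>. \<psi> = Exists x \<phi>")
    case True
    then obtain x \<phi> where \<psi>: "\<psi> = Exists x \<phi>" by blast
    obtain w where w: "w \<ge> N" "w \<notin> free_vars (Imp (And \<chi> \<psi>) bot)" "w \<notin> free_vars \<phi> \<union> bound_vars \<phi>"
      using ex_fresh_variable by blast
    let ?\<chi> = "And (And \<chi> \<psi>) (subst x (Var w) \<phi>)"
    have wf': "wf_form \<Omega> (And \<chi> \<psi>)" "wf_form \<Omega> (subst x (Var w) \<phi>)"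
      using wf \<psi> by (auto intro: wf_subst)
    have "\<not> provable \<Omega> (Imp ?\<chi> bot)"
      using consistent_add_Exists_witness[of \<chi> x \<phi> w] con' wf w \<psi> by simp
    moreover have "provable \<Omega> (Imp ?\<chi> \<chi>)" "provable \<Omega> (Imp ?\<chi> \<psi>)"
      using Imp_trans[OF And_left[OF wf'] left] Imp_trans[OF And_left[OF wf'] right] by auto
    moreover have "provable \<Omega> (Imp ?\<chi> (subst x (Var w) \<phi>))"
      using wf' by (rule And_right)
    ultimately show ?thesis
      using w wf' \<psi> unfolding decides_def by (intro exI[of _ ?\<chi>]) auto
  next
    case False
    then show ?thesis
      using con' left right wf unfolding decides_def by (intro exI[of _ "And \<chi> \<psi>"]) auto
  qed
next
  case True
  let ?n = "Imp \<psi> bot"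
  have wfn: "wf_form \<Omega> ?n" using wf wf_bot by simp
  \<comment> \<open>Here \<chi> refutes \<psi>. If it also refuted the classical negation, reductio
    would yield \<psi> and hence \<open>bot\<close>.\<close>
  have con': "\<not> provable \<Omega> (Imp (And \<chi> ?n) bot)"
    using Imp_MP[OF Imp_curry[OF True] Imp_classical] con by blast
  have left: "provable \<Omega> (Imp (And \<chi> ?n) \<chi>)" and right: "provable \<Omega> (Imp (And \<chi> ?n) ?n)"
    using wf wfn by (auto intro: And_left And_right)
  show ?thesis
  proof (cases "\<exists>x \<phi>. \<psi> = Forall x \<phi>")
    case True
    then obtain x \<phi> where \<psi>: "\<psi> = Forall x \<phi>" by blast
    obtain w where w: "w \<ge> N" "w \<notin> free_vars (And \<chi> ?n)" "w \<notin> free_vars \<phi> \<union> bound_vars \<phi>"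
      using ex_fresh_variable by blast
    let ?m = "Imp (subst x (Var w) \<phi>) bot"
    let ?\<chi> = "And (And \<chi> ?n) ?m"
    have wf': "wf_form \<Omega> (And \<chi> ?n)" "wf_form \<Omega> ?m"
      using wf wf_bot \<psi> by (auto intro: wf_subst)
    have "\<not> provable \<Omega> (Imp ?\<chi> bot)"
      using consistent_add_Forall_witness[of \<chi> x \<phi> w] con' wf w \<psi> by simp
    moreover have "provable \<Omega> (Imp ?\<chi> \<chi>)" "provable \<Omega> (Imp ?\<chi> ?n)"
      using Imp_trans[OF And_left[OF wf'] left] Imp_trans[OF And_left[OF wf'] right] by auto
    moreover have "provable \<Omega> (Imp ?\<chi> ?m)"
      using wf' by (rule And_right)
    ultimately show ?thesis
      using w wf' \<psi> unfolding decides_def by (intro exI[of _ ?\<chi>]) auto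
  next
    case False
    then show ?thesis
      using con' left right wf wfn unfolding decides_def by (intro exI[of _ "And \<chi> ?n"]) auto
  qed
qed

end

section \<open>Henkin sets as two-valued truth assignments\<close>

definition params :: "('c, 'f, 'p) signature \<Rightarrow> nat \<Rightarrow> ('c, 'f) tm set" where
  "params \<Omega> N = {t. wf_term \<Omega> t \<and> vars_tm t \<subseteq> {N..}}"

text \<open>Membership behaves as classical truth for the binary connectives. For \<open>Neg\<close>
  and \<open>Circ\<close> only the one-way conditions \<open>Neg_in\<close> and
  \<open>Circ_explosive\<close> are derived, from Ax10 and bc1.\<close>

locale henkin_set = RQmbC_falsum \<Omega> bot
  for \<Omega> :: "('c, 'f, 'p) signature" and bot +
  fixes N :: nat and T :: "('c, 'f, 'p) fm set"
  assumes wf: "\<alpha> \<in> T \<Longrightarrow> wf_form \<Omega> \<alpha>"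
    and provable_in: "provable \<Omega> \<alpha> \<Longrightarrow> \<alpha> \<in> T"
    and MP_closed: "Imp \<alpha> \<beta> \<in> T \<Longrightarrow> \<alpha> \<in> T \<Longrightarrow> \<beta> \<in> T"
    and bot_notin: "bot \<notin> T"
    and maximal: "wf_form \<Omega> \<alpha> \<Longrightarrow> \<alpha> \<notin> T \<Longrightarrow> Imp \<alpha> bot \<in> T"
    and Exists_witness: "Exists x \<phi> \<in> T \<Longrightarrow>
      \<exists>w\<ge>N. subst x (Var w) \<phi> \<in> T"
    and Forall_witness: "wf_form \<Omega> (Forall x \<phi>) \<Longrightarrow> Forall x \<phi> \<notin> T \<Longrightarrow>
      \<exists>w\<ge>N. subst x (Var w) \<phi> \<notin> T"
begin

lemma axiom_in: "\<alpha> \<in> RQmbC_axioms \<Omega> \<Longrightarrow> wf_form \<Omega> \<alpha> \<Longrightarrow> \<alpha> \<in> T"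
  by (simp add: provable_axiom provable_in)

lemma And_iff:
  assumes "wf_form \<Omega> \<alpha>" "wf_form \<Omega> \<beta>" shows "And \<alpha> \<beta> \<in> T \<longleftrightarrow> \<alpha> \<in> T \<and> \<beta> \<in> T"
proof -
  have "Imp \<alpha> (Imp \<beta> (And \<alpha> \<beta>)) \<in> T" "Imp (And \<alpha> \<beta>) \<alpha> \<in> T" "Imp (And \<alpha> \<beta>) \<beta> \<in> T"
    using assms by (auto intro!: axiom_in intro: RQmbC_axioms.intros)
  then show ?thesis using MP_closed by blast
qed

text \<open>Ax8 with \<open>bot\<close> as common conclusion refutes a disjunction with both
  disjuncts outside \<open>T\<close>.\<close>

lemma Or_iff:
  assumes "wf_form \<Omega> \<alpha>" "wf_form \<Omega> \<beta>" shows "Or \<alpha> \<beta> \<in> T \<longleftrightarrow> \<alpha> \<in> T \<or> \<beta> \<in> T"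
proof -
  have "Imp \<alpha> (Or \<alpha> \<beta>) \<in> T" "Imp \<beta> (Or \<alpha> \<beta>) \<in> T"
    "Imp (Imp \<alpha> bot) (Imp (Imp \<beta> bot) (Imp (Or \<alpha> \<beta>) bot)) \<in> T"
    using assms wf_bot by (auto intro!: axiom_in intro: RQmbC_axioms.intros)
  then show ?thesis using MP_closed maximal[OF assms(1)] maximal[OF assms(2)] bot_notin by blast
qed

text \<open>If \<alpha> is outside \<open>T\<close>, the implication comes from Ax9, split by
  \<open>Or_iff\<close>.\<close>

lemma Imp_iff:
  assumes "wf_form \<Omega> \<alpha>" "wf_form \<Omega> \<beta>" shows "Imp \<alpha> \<beta> \<in> T \<longleftrightarrow> \<alpha> \<notin> T \<or> \<beta> \<in> T"
proof -
  have "Imp \<beta> (Imp \<alpha> \<beta>) \<in> T" "Or (Imp \<alpha> \<beta>) \<alpha> \<in> T"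
    using assms by (auto intro!: axiom_in intro: RQmbC_axioms.intros)
  moreover from this have "Imp \<alpha> \<beta> \<in> T \<or> \<alpha> \<in> T"
    using Or_iff[of "Imp \<alpha> \<beta>" \<alpha>] assms by simp
  ultimately show ?thesis using MP_closed by blast
qed

lemma Neg_in: "wf_form \<Omega> \<alpha> \<Longrightarrow> \<alpha> \<notin> T \<Longrightarrow> Neg \<alpha> \<in> T"
proof -
  assume "wf_form \<Omega> \<alpha>" "\<alpha> \<notin> T"
  moreover from this have "Or \<alpha> (Neg \<alpha>) \<in> T"
    by (auto intro!: axiom_in intro: RQmbC_axioms.intros)
  ultimately show ?thesis using Or_iff[of \<alpha> "Neg \<alpha>"] by auto
qed

lemma Circ_explosive: "\<alpha> \<in> T \<Longrightarrow> Neg \<alpha> \<in> T \<Longrightarrow> Circ \<alpha> \<notin> T"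
proof
  assume *: "\<alpha> \<in> T" "Neg \<alpha> \<in> T" "Circ \<alpha> \<in> T"
  have "Imp (Circ \<alpha>) (Imp \<alpha> (Imp (Neg \<alpha>) bot)) \<in> T"
    using wf[OF *(1)] wf_bot by (auto intro!: axiom_in intro: RQmbC_axioms.intros)
  then show False using * MP_closed bot_notin by blast
qed

text \<open>Instances at \<open>params\<close> capture nothing, their variables being at least
  \<open>N\<close> and the bound ones below it. Conversely, a counterexample to a missing universal
  is a variable from \<open>N\<close> on, and so itself belongs to \<open>params\<close>.\<close>

lemma Forall_iff:
  assumes "wf_form \<Omega> \<phi>" "bound_vars \<phi> \<subseteq> {..<N}"
  shows "Forall x \<phi> \<in> T \<longleftrightarrow> (\<forall>t\<in>params \<Omega> N. subst x t \<phi> \<in> T)"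
proof
  assume *: "Forall x \<phi> \<in> T"
  show "\<forall>t\<in>params \<Omega> N. subst x t \<phi> \<in> T"
  proof
    fix t assume t: "t \<in> params \<Omega> N"
    then have "bound_vars \<phi> \<inter> vars_tm t = {}" using assms(2) by (force simp: params_def)
    then have "free_for x t \<phi>" by (rule free_forI)
    then have "Imp (Forall x \<phi>) (subst x t \<phi>) \<in> T"
      using t assms by (intro axiom_in RQmbC_axioms.AxAll) (auto simp: params_def wf_subst)
    then show "subst x t \<phi> \<in> T" using * by (rule MP_closed)
  qed
next
  assume "\<forall>t\<in>params \<Omega> N. subst x t \<phi> \<in> T"
  then have "\<forall>w\<ge>N. subst x (Var w) \<phi> \<in> T" by (simp add: params_def)
  then show "Forall x \<phi> \<in> T" using Forall_witness[of x \<phi>] assms by auto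
qed

lemma Exists_iff:
  assumes "wf_form \<Omega> \<phi>" "bound_vars \<phi> \<subseteq> {..<N}"
  shows "Exists x \<phi> \<in> T \<longleftrightarrow> (\<exists>t\<in>params \<Omega> N. subst x t \<phi> \<in> T)"
proof
  assume "Exists x \<phi> \<in> T"
  then obtain w where "w \<ge> N" "subst x (Var w) \<phi> \<in> T" using Exists_witness by blast
  then show "\<exists>t\<in>params \<Omega> N. subst x t \<phi> \<in> T"
    by (intro bexI[of _ "Var w"]) (auto simp: params_def)
next
  assume "\<exists>t\<in>params \<Omega> N. subst x t \<phi> \<in> T"
  then obtain t where t: "t \<in> params \<Omega> N" "subst x t \<phi> \<in> T" by blast
  then have "bound_vars \<phi> \<inter> vars_tm t = {}" using assms(2) by (force simp: params_def)
  then have "free_for x t \<phi>" by (rule free_forI)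
  then have "Imp (subst x t \<phi>) (Exists x \<phi>) \<in> T"
    using t assms by (intro axiom_in RQmbC_axioms.AxEx) (auto simp: params_def wf_subst)
  then show "Exists x \<phi> \<in> T" using t(2) by (rule MP_closed)
qed

end

text \<open>Lindenbaum's construction with witnesses: starting from the classical negation of
  \<alpha>, a chain of ever stronger consistent formulas decides the enumerated formulas one by one,
  and \<open>T\<close> collects their consequences.\<close>

lemma (in RQmbC_falsum) ex_henkin_set:
  assumes "countable (For1 \<Omega>)" "wf_form \<Omega> \<alpha>" "\<not> provable \<Omega> \<alpha>"
  shows "\<exists>T. henkin_set \<Omega> bot N T \<and> \<alpha> \<notin> T"
proof -
  have "For1 \<Omega> \<noteq> {}" using assms(2) by (auto simp: For1_def)
  then obtain e :: "nat \<Rightarrow> _" where e: "range e = For1 \<Omega>"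
    using range_from_nat_into[OF _ assms(1)] by blast
  \<comment> \<open>The last conjunct pins the start of the chain.\<close>
  let ?P = "\<lambda>(n :: nat) \<chi>. wf_form \<Omega> \<chi> \<and> \<not> provable \<Omega> (Imp \<chi> bot) \<and> (n = 0 \<longrightarrow> \<chi> = Imp \<alpha> bot)"
  let ?Q = "\<lambda>n \<chi> \<chi>'. provable \<Omega> (Imp \<chi>' \<chi>) \<and> decides N (e n) \<chi>'"
  have "\<exists>f. \<forall>n. ?P n (f n) \<and> ?Q n (f n) (f (Suc n))"
  proof (rule dependent_nat_choice)
    have "\<not> provable \<Omega> (Imp (Imp \<alpha> bot) bot)"
    proof
      \<comment> \<open>A provable dummy antecedent that brings the formula into the shape of
        \<open>Imp_classical\<close> and is discharged afterwards.\<close>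
      let ?top = "Imp bot bot"
      assume "provable \<Omega> (Imp (Imp \<alpha> bot) bot)"
      then have "provable \<Omega> (Imp (And ?top (Imp \<alpha> bot)) bot)"
        using assms(2) wf_bot by (intro Imp_trans[OF And_right]) auto
      then have "provable \<Omega> (Imp ?top \<alpha>)" by (rule Imp_classical)
      then show False using assms(3) provable_MP[OF _ Imp_refl[OF wf_bot]] by blast
    qed
    then show "\<exists>\<chi>. ?P 0 \<chi>" using assms(2) wf_bot by auto
  next
    fix \<chi> n assume "?P n \<chi>"
    moreover have "wf_form \<Omega> (e n)" using e by (auto simp: For1_def)
    ultimately show "\<exists>\<chi>'. ?P (Suc n) \<chi>' \<and> ?Q n \<chi> \<chi>'"
      using consistent_extend[of \<chi> "e n" N] by auto
  qed
  then obtain f where "\<forall>n. ?P n (f n) \<and> ?Q n (f n) (f (Suc n))" by (elim exE)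
  then have f_wf: "wf_form \<Omega> (f n)" and f_con: "\<not> provable \<Omega> (Imp (f n) bot)"
    and f_0: "f 0 = Imp \<alpha> bot" and f_mono: "provable \<Omega> (Imp (f (Suc n)) (f n))"
    and f_dec: "decides N (e n) (f (Suc n))" for n
    by simp_all
  have mono: "provable \<Omega> (Imp (f n) (f m))" if "m \<le> n" for m n
    using that
  proof (induction rule: dec_induct)
    case base
    show ?case by (rule Imp_refl[OF f_wf])
  next
    case (step n)
    then show ?case using Imp_trans[OF f_mono step.IH] by blast
  qed
  define T where "T = {\<beta>. \<exists>n. provable \<Omega> (Imp (f n) \<beta>)}"
  \<comment> \<open>Later stages imply earlier ones, so two members of \<open>T\<close> already
    follow from one common stage.\<close>
  have T_E: "\<exists>n. provable \<Omega> (Imp (f n) \<beta>) \<and> provable \<Omega> (Imp (f n) \<gamma>)"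
    if in_T: "\<beta> \<in> T" "\<gamma> \<in> T" for \<beta> \<gamma>
  proof -
    obtain m n where m: "provable \<Omega> (Imp (f m) \<beta>)" and n: "provable \<Omega> (Imp (f n) \<gamma>)"
      using in_T unfolding T_def by blast
    show ?thesis
      using Imp_trans[OF mono[OF max.cobounded1] m] Imp_trans[OF mono[OF max.cobounded2] n] by blast
  qed
  have MP: "\<gamma> \<in> T" if in_T: "Imp \<beta> \<gamma> \<in> T" "\<beta> \<in> T" for \<beta> \<gamma>
    using T_E[OF in_T] Imp_MP[of \<Omega> _ \<beta> \<gamma>] unfolding T_def by blast
  have bot: "bot \<notin> T" using f_con by (simp add: T_def)
  have contr: "\<beta> \<notin> T" if "Imp \<beta> bot \<in> T" for \<beta>
    using MP[OF that] bot by blast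
  \<comment> \<open>The formula \<open>e n\<close> is decided by stage \<open>Suc n\<close>, whose
    consequences all lie in \<open>T\<close>; this turns the alternatives of \<open>decides\<close>
    into statements about membership.\<close>
  have dec: "\<exists>\<chi>. decides N \<beta> \<chi> \<and> (\<forall>\<gamma>. provable \<Omega> (Imp \<chi> \<gamma>) \<longrightarrow> \<gamma> \<in> T)" if "wf_form \<Omega> \<beta>" for \<beta>
  proof -
    have "\<beta> \<in> range e" using e that by (simp add: For1_def)
    then obtain n where "\<beta> = e n" by (rule rangeE)
    then show ?thesis using f_dec[of n] unfolding T_def by blast
  qed
  have "henkin_set \<Omega> bot N T"
  proof
    show wf: "wf_form \<Omega> \<beta>" if "\<beta> \<in> T" for \<beta>
      using that provable_wf[of \<Omega> "Imp _ \<beta>"] unfolding T_def by auto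
    show "\<beta> \<in> T" if "provable \<Omega> \<beta>" for \<beta>
      using Imp_const[OF that f_wf] unfolding T_def by blast
    show "\<gamma> \<in> T" if "Imp \<beta> \<gamma> \<in> T" "\<beta> \<in> T" for \<beta> \<gamma> using that by (rule MP)
    show "bot \<notin> T" by (rule bot)
    show "Imp \<beta> bot \<in> T" if "wf_form \<Omega> \<beta>" "\<beta> \<notin> T" for \<beta>
      using dec[OF that(1)] that(2) unfolding decides_def by blast
    show "\<exists>w\<ge>N. subst x (Var w) \<phi> \<in> T" if "Exists x \<phi> \<in> T" for x \<phi>
      using dec[OF wf[OF that]] that contr unfolding decides_def by blast
    show "\<exists>w\<ge>N. subst x (Var w) \<phi> \<notin> T"
      if "wf_form \<Omega> (Forall x \<phi>)" "Forall x \<phi> \<notin> T" for x \<phi>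
      using dec[OF that(1)] that(2) contr unfolding decides_def by blast
  qed
  moreover have "\<alpha> \<notin> T"
  proof (rule contr)
    have "provable \<Omega> (Imp (f 0) (Imp \<alpha> bot))" using Imp_refl[OF f_wf, of 0] f_0 by simp
    then show "Imp \<alpha> bot \<in> T" unfolding T_def by blast
  qed
  ultimately show ?thesis by blast
qed


section \<open>Power set BALFIs\<close>

text \<open>The power set algebra is carried along \<open>j\<close> because the elements of the
  algebra must live in the type \<open>'a\<close>. The operations \<open>ng\<close> and
  \<open>ci\<close> are parameters, as the Boolean structure does not determine them.\<close>

definition powerset_balfi ::
    "('x set \<Rightarrow> 'a) \<Rightarrow> ('x set \<Rightarrow> 'x set) \<Rightarrow> ('x set \<Rightarrow> 'x set) \<Rightarrow> 'a balfi" where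
  "powerset_balfi j ng ci =
     \<lparr>carrier = range j,
      bmeet = (\<lambda>a b. j (inv j a \<inter> inv j b)),
      bjoin = (\<lambda>a b. j (inv j a \<union> inv j b)),
      bimp = (\<lambda>a b. j (- inv j a \<union> inv j b)),
      bneg = (\<lambda>a. j (ng (inv j a))),
      bcirc = (\<lambda>a. j (ci (inv j a))),
      bzero = j {},
      bone = j UNIV\<rparr>"

locale powerset_with_ops =
  fixes j :: "'x set \<Rightarrow> 'a" and ng ci :: "'x set \<Rightarrow> 'x set"
  assumes inj: "inj j"
    and ng: "A \<union> ng A = UNIV"
    and ng_ci: "A \<inter> ng A \<inter> ci A = {}"
begin

abbreviation "B \<equiv> powerset_balfi j ng ci"

lemma B_simps:
  "carrier B = range j"
  "bmeet B (j X) (j Y) = j (X \<inter> Y)"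
  "bjoin B (j X) (j Y) = j (X \<union> Y)"
  "bimp B (j X) (j Y) = j (- X \<union> Y)"
  "bneg B (j X) = j (ng X)"
  "bcirc B (j X) = j (ci X)"
  "bzero B = j {}"
  "bone B = j UNIV"
  using inj by (simp_all add: powerset_balfi_def)

lemma balfi: "balfi B"
proof
  fix a assume "a \<in> carrier B"
  then obtain X where X: "a = j X" by (auto simp: B_simps)
  show "\<exists>c\<in>carrier B. bmeet B a c = bzero B \<and> bjoin B a c = bone B \<and>
      (\<forall>b\<in>carrier B. bimp B a b = bjoin B c b)"
    by (rule bexI[of _ "j (- X)"]) (auto simp: B_simps X)
qed (auto simp: B_simps inj_eq[OF inj] ng ng_ci)

abbreviation "L \<equiv> balfi_order B"

lemma L_simps: "carrier L = range j" "(.=\<^bsub>L\<^esub>) = (=)" "j X \<sqsubseteq>\<^bsub>L\<^esub> j Y \<longleftrightarrow> X \<subseteq> Y"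
  using inj by (auto simp: balfi_order_def B_simps inj_eq)

sublocale partial_order L
proof
  fix x y z assume "x \<in> carrier L" "y \<in> carrier L" "z \<in> carrier L"
  then show "x \<sqsubseteq>\<^bsub>L\<^esub> y \<Longrightarrow> y \<sqsubseteq>\<^bsub>L\<^esub> z \<Longrightarrow> x \<sqsubseteq>\<^bsub>L\<^esub> z" by (auto simp: L_simps)
qed (auto simp: L_simps)

lemma is_glb_INT: "is_glb L (j (\<Inter>\<A>)) (j ` \<A>)"
proof -
  have "Lower L (j ` \<A>) = {a \<in> range j. \<forall>Y\<in>\<A>. a \<sqsubseteq>\<^bsub>L\<^esub> j Y}"
    unfolding Lower_def L_simps by auto
  then show ?thesis by (auto simp: greatest_def L_simps) blast
qed

lemma is_lub_UN: "is_lub L (j (\<Union>\<A>)) (j ` \<A>)"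
proof -
  have "Upper L (j ` \<A>) = {a \<in> range j. \<forall>Y\<in>\<A>. j Y \<sqsubseteq>\<^bsub>L\<^esub> a}"
    unfolding Upper_def L_simps by auto
  then show ?thesis by (auto simp: least_def L_simps) blast
qed

lemma complete: "complete_balfi B"
  unfolding complete_balfi_def
proof (intro conjI balfi complete_latticeI)
  fix A assume "A \<subseteq> carrier L"
  then obtain \<A> where "A = j ` \<A>" unfolding L_simps by (auto simp: subset_image_iff)
  then show "\<exists>s. is_lub L s A" "\<exists>i. is_glb L i A"
    using is_glb_INT[of \<A>] is_lub_UN[of \<A>] by auto
qed

text \<open>\<open>infi\<close> is defined by choice; antisymmetry makes the greatest lower bound
  unique, so the chosen value is the intersection.\<close>

lemma infi_eq:
  assumes "\<And>u. u \<in> I \<Longrightarrow> F u = j (G u)"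
  shows "infi L I F = j (\<Inter>u\<in>I. G u)"
proof -
  have "F ` I = j ` G ` I" using assms by (auto simp: image_image)
  then have "is_glb L (j (\<Inter>u\<in>I. G u)) (F ` I)" using is_glb_INT[of "G ` I"] by simp
  then show ?thesis unfolding infi_def inf_def
    using greatest_unique by (intro some_equality)
qed

lemma supr_eq:
  assumes "\<And>u. u \<in> I \<Longrightarrow> F u = j (G u)"
  shows "supr L I F = j (\<Union>u\<in>I. G u)"
proof -
  have "F ` I = j ` G ` I" using assms by (auto simp: image_image)
  then have "is_lub L (j (\<Union>u\<in>I. G u)) (F ` I)" using is_lub_UN[of "G ` I"] by simp
  then show ?thesis unfolding supr_def sup_def
    using least_unique by (intro some_equality)
qed

end


section \<open>The canonical structure\<close>

locale canonical =
  fixes \<Omega> :: "('c, 'f, 'p) signature" and bot :: "('c, 'f, 'p) fm" and N :: nat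
    and T :: "nat \<Rightarrow> ('c, 'f, 'p) fm set"
    and j :: "nat set \<Rightarrow> 'a" and i :: "('c, 'f) tm \<Rightarrow> 'u"
  assumes henkin: "henkin_set \<Omega> bot N (T n)"
    and separating: "wf_form \<Omega> \<alpha> \<Longrightarrow> \<not> provable \<Omega> \<alpha> \<Longrightarrow> \<exists>n. \<alpha> \<notin> T n"
    and inj_j: "inj j"
    and inj_i: "inj_on i (params \<Omega> N)"
begin

definition h :: "('c, 'f, 'p) fm \<Rightarrow> nat set" where
  "h \<alpha> = {n. \<alpha> \<in> T n}"

definition ng :: "nat set \<Rightarrow> nat set" where
  "ng A = (if \<exists>\<alpha>. wf_form \<Omega> \<alpha> \<and> h \<alpha> = A then h (Neg (SOME \<alpha>. wf_form \<Omega> \<alpha> \<and> h \<alpha> = A)) else UNIV)"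

definition ci :: "nat set \<Rightarrow> nat set" where
  "ci A = (if \<exists>\<alpha>. wf_form \<Omega> \<alpha> \<and> h \<alpha> = A then h (Circ (SOME \<alpha>. wf_form \<Omega> \<alpha> \<and> h \<alpha> = A)) else {})"

lemma h_And: "wf_form \<Omega> \<alpha> \<Longrightarrow> wf_form \<Omega> \<beta> \<Longrightarrow> h (And \<alpha> \<beta>) = h \<alpha> \<inter> h \<beta>"
  and h_Or: "wf_form \<Omega> \<alpha> \<Longrightarrow> wf_form \<Omega> \<beta> \<Longrightarrow> h (Or \<alpha> \<beta>) = h \<alpha> \<union> h \<beta>"
  and h_Imp: "wf_form \<Omega> \<alpha> \<Longrightarrow> wf_form \<Omega> \<beta> \<Longrightarrow> h (Imp \<alpha> \<beta>) = - h \<alpha> \<union> h \<beta>"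
  using henkin_set.And_iff[OF henkin] henkin_set.Or_iff[OF henkin] henkin_set.Imp_iff[OF henkin]
  by (auto simp: h_def)

lemma h_Forall:
  assumes "wf_form \<Omega> \<phi>" "bound_vars \<phi> \<subseteq> {..<N}"
  shows "h (Forall x \<phi>) = (\<Inter>t\<in>params \<Omega> N. h (subst x t \<phi>))"
  using henkin_set.Forall_iff[OF henkin assms] by (auto simp: h_def)

lemma h_Exists:
  assumes "wf_form \<Omega> \<phi>" "bound_vars \<phi> \<subseteq> {..<N}"
  shows "h (Exists x \<phi>) = (\<Union>t\<in>params \<Omega> N. h (subst x t \<phi>))"
  using henkin_set.Exists_iff[OF henkin assms] by (auto simp: h_def)

lemma h_provable: "provable \<Omega> \<alpha> \<Longrightarrow> h \<alpha> = UNIV"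
  using henkin_set.provable_in[OF henkin] by (auto simp: h_def)

text \<open>If the values agree, the equivalence lies in every \<open>T n\<close> and is provable by
  separation. The whole family matters here: a single set would leave at most two classes of
  formulas.\<close>

lemma provable_Iff:
  assumes "wf_form \<Omega> \<alpha>" "wf_form \<Omega> \<beta>"
  shows "provable \<Omega> (Iff \<alpha> \<beta>) \<longleftrightarrow> h \<alpha> = h \<beta>"
proof -
  have "h (Iff \<alpha> \<beta>) = UNIV \<longleftrightarrow> h \<alpha> = h \<beta>"
    using assms by (auto simp: h_And h_Imp)
  moreover have "provable \<Omega> (Iff \<alpha> \<beta>) \<longleftrightarrow> h (Iff \<alpha> \<beta>) = UNIV"
    using h_provable[of "Iff \<alpha> \<beta>"] separating[of "Iff \<alpha> \<beta>"] assms by (auto simp: h_def)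
  ultimately show ?thesis by simp
qed

lemma representative:
  assumes "wf_form \<Omega> \<alpha>"
  defines "\<beta> \<equiv> SOME \<beta>. wf_form \<Omega> \<beta> \<and> h \<beta> = h \<alpha>"
  shows "wf_form \<Omega> \<beta>" "provable \<Omega> (Iff \<beta> \<alpha>)"
proof -
  have *: "wf_form \<Omega> \<beta> \<and> h \<beta> = h \<alpha>"
    unfolding \<beta>_def by (rule someI[of _ \<alpha>]) (simp add: assms(1))
  then show "wf_form \<Omega> \<beta>" by simp
  show "provable \<Omega> (Iff \<beta> \<alpha>)" using * assms(1) by (simp add: provable_Iff)
qed

text \<open>The representative chosen in \<open>ng\<close> is provably equivalent to \<alpha>. The
  replacement rule for negation carries this over to the negated formulas, so the choice does not
  affect the value.\<close>

lemma ng_h: "wf_form \<Omega> \<alpha> \<Longrightarrow> ng (h \<alpha>) = h (Neg \<alpha>)"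
proof -
  assume \<alpha>: "wf_form \<Omega> \<alpha>"
  note r = representative[OF \<alpha>]
  have "h (Neg (SOME \<beta>. wf_form \<Omega> \<beta> \<and> h \<beta> = h \<alpha>)) = h (Neg \<alpha>)"
    using provable_Iff_Neg[OF r(2)] provable_Iff r(1) \<alpha> by simp
  then show ?thesis using \<alpha> by (auto simp: ng_def)
qed

lemma ci_h: "wf_form \<Omega> \<alpha> \<Longrightarrow> ci (h \<alpha>) = h (Circ \<alpha>)"
proof -
  assume \<alpha>: "wf_form \<Omega> \<alpha>"
  note r = representative[OF \<alpha>]
  have "h (Circ (SOME \<beta>. wf_form \<Omega> \<beta> \<and> h \<beta> = h \<alpha>)) = h (Circ \<alpha>)"
    using provable_Iff_Circ[OF r(2)] provable_Iff r(1) \<alpha> by simp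
  then show ?thesis using \<alpha> by (auto simp: ci_def)
qed

sublocale powerset_with_ops j ng ci
proof
  fix A
  have "A \<union> ng A = UNIV \<and> A \<inter> ng A \<inter> ci A = {}"
  proof (cases "\<exists>\<alpha>. wf_form \<Omega> \<alpha> \<and> h \<alpha> = A")
    case True
    then obtain \<alpha> where \<alpha>: "wf_form \<Omega> \<alpha>" "A = h \<alpha>" by blast
    \<comment> \<open>On the image of \<open>h\<close> both equations hold at each index
      separately.\<close>
    show ?thesis
      using henkin_set.Neg_in[OF henkin \<alpha>(1)] henkin_set.Circ_explosive[OF henkin, of \<alpha>]
      unfolding \<alpha>(2) ng_h[OF \<alpha>(1)] ci_h[OF \<alpha>(1)] by (auto simp: h_def)
  next
    case False
    then have "ng A = UNIV" "ci A = {}" by (simp_all only: ng_def ci_def if_False)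
    then show ?thesis by simp
  qed
  then show "A \<union> ng A = UNIV" "A \<inter> ng A \<inter> ci A = {}" by simp_all
qed (rule inj_j)

text \<open>The term model, with terms coded by \<open>i\<close> and truth values by
  \<open>j\<close>.\<close>

definition S :: "('u, 'a, 'c, 'f, 'p) fo_struct" where
  "S = \<lparr>dom = i ` params \<Omega> N,
        alg = B,
        cst_int = (\<lambda>c. i (Cst c)),
        fun_int = (\<lambda>f us. i (Fn f (map (inv_into (params \<Omega> N) i) us))),
        pred_int = (\<lambda>P us. j (h (Atom P (map (inv_into (params \<Omega> N) i) us))))\<rparr>"

lemma S_simps:
  "dom S = i ` params \<Omega> N"
  "alg S = B"
  "cst_int S c = i (Cst c)"
  "fun_int S f us = i (Fn f (map (inv_into (params \<Omega> N) i) us))"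
  "pred_int S P us = j (h (Atom P (map (inv_into (params \<Omega> N) i) us)))"
  by (simp_all add: S_def)

lemma inv_into_i: "t \<in> params \<Omega> N \<Longrightarrow> inv_into (params \<Omega> N) i (i t) = t"
  using inj_i by simp

lemma Var_in_params: "Var N \<in> params \<Omega> N"
  by (simp add: params_def)

lemma is_structure_S: "is_structure \<Omega> S"
  unfolding is_structure_def
proof (intro conjI ballI allI impI)
  show "dom S \<noteq> {}" using Var_in_params by (auto simp: S_simps)
  show "complete_balfi (alg S)" using complete by (simp add: S_simps)
  show "cst_int S c \<in> dom S" if "c \<in> sig_csts \<Omega>" for c
    using that by (simp add: S_simps params_def)
  show "pred_int S P us \<in> carrier (alg S)" for P us
    by (simp add: S_simps B_simps)
  fix n f us
  assume *: "1 \<le> n" "f \<in> sig_funs \<Omega> n" "length us = n \<and> set us \<subseteq> dom S"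
  have "inv_into (params \<Omega> N) i u \<in> params \<Omega> N" if "u \<in> set us" for u
    using * that by (intro inv_into_into) (auto simp: S_simps)
  then have "Fn f (map (inv_into (params \<Omega> N) i) us) \<in> params \<Omega> N"
    using * by (auto simp: params_def)
  then show "fun_int S f us \<in> dom S" by (simp add: S_simps)
qed

section \<open>Evaluation in the canonical structure\<close>

lemma psubst_tm_params:
  "range \<sigma> \<subseteq> params \<Omega> N \<Longrightarrow> wf_term \<Omega> t \<Longrightarrow> psubst_tm \<sigma> t \<in> params \<Omega> N"
  by (induction t) (auto simp: params_def subset_iff)

lemma eval_tm_S:
  assumes "range \<sigma> \<subseteq> params \<Omega> N" "wf_term \<Omega> t"
  shows "eval_tm S (i \<circ> \<sigma>) t = i (psubst_tm \<sigma> t)"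
  using assms(2)
proof (induction t)
  case (Fn f ts)
  then have "map (eval_tm S (i \<circ> \<sigma>)) ts = map (\<lambda>t. i (psubst_tm \<sigma> t)) ts"
    by (intro map_cong refl Fn.IH) simp_all
  moreover have "map (inv_into (params \<Omega> N) i) (map (\<lambda>t. i (psubst_tm \<sigma> t)) ts) = map (psubst_tm \<sigma>) ts"
    using Fn psubst_tm_params[OF assms(1)] by (simp add: inv_into_i)
  ultimately show ?case by (simp only: eval_tm.simps psubst_tm.simps S_simps)
qed (simp_all add: S_simps)

text \<open>Terms in \<open>params\<close> avoid variables below \<open>N\<close>, so no value of
  \<sigma> brings in \<open>x\<close>, as \<open>subst_psubst\<close> demands.\<close>

lemma subst_psubst_params:
  assumes "range \<sigma> \<subseteq> params \<Omega> N" "x < N"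
  shows "subst x t (psubst (\<sigma>(x := Var x)) \<phi>) = psubst (\<sigma>(x := t)) \<phi>"
proof -
  have "\<sigma> y \<in> params \<Omega> N" for y using assms(1) by blast
  then have "x \<notin> vars_tm (\<sigma> y)" for y using assms(2) by (fastforce simp: params_def)
  then show ?thesis using subst_psubst[of "\<sigma>(x := Var x)" x t \<phi>] by simp
qed

text \<open>The truth lemma, by induction for all \<sigma> at once because quantifiers change the
  assignment. The bound on the bound variables makes \<open>h_Forall\<close> and
  \<open>h_Exists\<close> applicable.\<close>

lemma eval_fm_S:
  assumes "range \<sigma> \<subseteq> params \<Omega> N" "wf_form \<Omega> \<phi>" "bound_vars \<phi> \<subseteq> {..<N}"
  shows "eval_fm S (i \<circ> \<sigma>) \<phi> = j (h (psubst \<sigma> \<phi>))"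
proof -
  \<comment> \<open>Stated for all well-formed substitutions, since
    \<open>\<sigma>(x := Var x)\<close> with \<open>x < N\<close> takes a value outside
    \<open>params\<close>.\<close>
  have wf: "wf_form \<Omega> (psubst \<tau> \<psi>)" if "\<And>x. wf_term \<Omega> (\<tau> x)" "wf_form \<Omega> \<psi>"
    for \<tau> and \<psi> :: "('c, 'f, 'p) fm"
    using that by (simp add: wf_psubst)
  have wf_params: "wf_term \<Omega> (\<tau> x)" if "range \<tau> \<subseteq> params \<Omega> N" for \<tau> :: "nat \<Rightarrow> ('c, 'f) tm" and x
    using that by (auto simp: params_def)
  \<comment> \<open>The induction hypothesis at \<open>\<tau>(x := t)\<close>, rewritten to match
    the instances in \<open>h_Forall\<close> and \<open>h_Exists\<close>.\<close>
  have upd: "eval_fm S ((i \<circ> \<tau>)(x := i t)) \<psi> = j (h (subst x t (psubst (\<tau>(x := Var x)) \<psi>)))"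
    if "\<And>\<sigma>. range \<sigma> \<subseteq> params \<Omega> N \<Longrightarrow> eval_fm S (i \<circ> \<sigma>) \<psi> = j (h (psubst \<sigma> \<psi>))"
      "range \<tau> \<subseteq> params \<Omega> N" "x < N" "t \<in> params \<Omega> N"
    for \<psi> \<tau> x t
  proof -
    have "range (\<tau>(x := t)) \<subseteq> params \<Omega> N" using that by auto
    then show ?thesis
      using that(1) unfolding subst_psubst_params[OF that(2,3)] fun_upd_comp[symmetric] by blast
  qed
  show ?thesis
    using assms
  proof (induction \<phi> arbitrary: \<sigma>)
    case (Atom P ts)
    then have "map (eval_tm S (i \<circ> \<sigma>)) ts = map (\<lambda>t. i (psubst_tm \<sigma> t)) ts"
      by (intro map_cong eval_tm_S) auto
    moreover have "map (inv_into (params \<Omega> N) i) (map (\<lambda>t. i (psubst_tm \<sigma> t)) ts) = map (psubst_tm \<sigma>) ts"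
      using Atom psubst_tm_params[OF Atom(1)] by (simp add: inv_into_i)
    ultimately show ?case by (simp only: eval_fm.simps psubst.simps S_simps)
  next
    case (Forall x \<phi>)
    let ?\<psi> = "psubst (\<sigma>(x := Var x)) \<phi>"
    have "eval_fm S (i \<circ> \<sigma>) (Forall x \<phi>) =
        j (\<Inter>u\<in>i ` params \<Omega> N. h (subst x (inv_into (params \<Omega> N) i u) ?\<psi>))"
      unfolding eval_fm.simps S_simps
    proof (rule infi_eq)
      fix u assume "u \<in> i ` params \<Omega> N"
      then obtain t where t: "t \<in> params \<Omega> N" "u = i t" by blast
      then show "eval_fm S ((i \<circ> \<sigma>)(x := u)) \<phi> = j (h (subst x (inv_into (params \<Omega> N) i u) ?\<psi>))"
        using upd[OF Forall.IH Forall.prems(1) _ t(1)] Forall.prems by (simp add: inv_into_i)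
    qed
    also have "\<dots> = j (\<Inter>t\<in>params \<Omega> N. h (subst x t ?\<psi>))"
      by (simp add: inv_into_i)
    \<comment> \<open>Simultaneous substitution keeps the bound variables, so those of
      \<open>?\<psi>\<close> are still below \<open>N\<close>.\<close>
    also have "\<dots> = j (h (Forall x ?\<psi>))"
      using Forall.prems wf_params[OF Forall.prems(1)]
      by (subst h_Forall) (auto simp: bound_vars_psubst intro!: wf)
    finally show ?case by (simp only: psubst.simps)
  next
    case (Exists x \<phi>)
    let ?\<psi> = "psubst (\<sigma>(x := Var x)) \<phi>"
    have "eval_fm S (i \<circ> \<sigma>) (Exists x \<phi>) =
        j (\<Union>u\<in>i ` params \<Omega> N. h (subst x (inv_into (params \<Omega> N) i u) ?\<psi>))"
      unfolding eval_fm.simps S_simps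
    proof (rule supr_eq)
      fix u assume "u \<in> i ` params \<Omega> N"
      then obtain t where t: "t \<in> params \<Omega> N" "u = i t" by blast
      then show "eval_fm S ((i \<circ> \<sigma>)(x := u)) \<phi> = j (h (subst x (inv_into (params \<Omega> N) i u) ?\<psi>))"
        using upd[OF Exists.IH Exists.prems(1) _ t(1)] Exists.prems by (simp add: inv_into_i)
    qed
    also have "\<dots> = j (\<Union>t\<in>params \<Omega> N. h (subst x t ?\<psi>))"
      by (simp add: inv_into_i)
    also have "\<dots> = j (h (Exists x ?\<psi>))"
      using Exists.prems wf_params[OF Exists.prems(1)]
      by (subst h_Exists) (auto simp: bound_vars_psubst intro!: wf)
    finally show ?case by (simp only: psubst.simps)
  qed (simp_all add: S_simps B_simps h_And h_Or h_Imp ng_h ci_h wf wf_params)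
qed

lemma eval_sentence_S:
  assumes "\<phi> \<in> Sen \<Omega>" "bound_vars \<phi> \<subseteq> {..<N}"
  shows "eval_fm S (\<lambda>_. i (Var N)) \<phi> = j (h \<phi>)"
proof -
  have "eval_fm S (i \<circ> (\<lambda>_. Var N)) \<phi> = j (h (psubst (\<lambda>_. Var N) \<phi>))"
    using assms Var_in_params by (intro eval_fm_S) (auto simp: Sen_def For1_def)
  moreover have "psubst (\<lambda>_. Var N) \<phi> = \<phi>"
    using assms(1) by (intro psubst_closed) (simp add: Sen_def)
  ultimately show ?thesis by (simp add: comp_def)
qed

end


section \<open>Completeness\<close>

lemma valid_imp_provable:
  fixes \<Omega> :: "('c, 'f, 'p) signature" and \<phi> :: "('c, 'f, 'p) fm"
  assumes large: "large_types TYPE('u) TYPE('a)"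
    and sig: "is_signature \<Omega>"
    and sen: "\<phi> \<in> Sen \<Omega>"
    and valid: "valid TYPE('u) TYPE('a) \<Omega> \<phi>"
  shows "provable \<Omega> \<phi>"
proof (rule ccontr)
  assume unprovable: "\<not> provable \<Omega> \<phi>"
  have wf: "wf_form \<Omega> \<phi>" using sen by (simp add: Sen_def For1_def)
  \<comment> \<open>Any well-formed formula yields a falsum in this way; \<phi> is at hand.\<close>
  define bot where "bot = And (Circ \<phi>) (And \<phi> (Neg \<phi>))"
  interpret RQmbC_falsum \<Omega> bot
    unfolding bot_def using wf by (rule RQmbC_falsum_bc1)
  obtain N where N: "bound_vars \<phi> \<subseteq> {..<N}"
    using finite_bound_vars finite_nat_set_iff_bounded by (metis lessThan_iff subsetI)
  obtain e :: "nat \<Rightarrow> _" where e: "range e = For1 \<Omega>"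
    using range_from_nat_into[OF _ countable_For1[OF sig]] sen by (force simp: Sen_def)
  have "\<exists>T. henkin_set \<Omega> bot N T \<and> (provable \<Omega> (e n) \<or> e n \<notin> T)" for n
  proof (cases "provable \<Omega> (e n)")
    case True
    \<comment> \<open>There is nothing to omit at this index; a set omitting \<phi> fills the
      place.\<close>
    then show ?thesis using ex_henkin_set[OF countable_For1[OF sig] wf unprovable] by blast
  next
    case False
    moreover have "wf_form \<Omega> (e n)" using e by (auto simp: For1_def)
    ultimately show ?thesis using ex_henkin_set[OF countable_For1[OF sig]] by blast
  qed
  then obtain T where T: "\<And>n. henkin_set \<Omega> bot N (T n)" "\<And>n. provable \<Omega> (e n) \<or> e n \<notin> T n"
    by metis
  obtain j :: "nat set \<Rightarrow> 'a" where j: "inj j"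
    using large by (auto simp: large_types_def lepoll_def)
  obtain k :: "nat \<Rightarrow> 'u" where k: "inj k"
    using large by (auto simp: large_types_def lepoll_def)
  have "countable (params \<Omega> N)"
    by (rule countable_subset[OF _ countable_wf_terms[OF sig]]) (auto simp: params_def)
  \<comment> \<open>The terms are countable, so they embed into the domain type through the natural
    numbers.\<close>
  then have i: "inj_on (k \<circ> to_nat_on (params \<Omega> N)) (params \<Omega> N)"
    using k by (intro comp_inj_on) (auto intro: inj_on_subset)
  interpret canonical \<Omega> bot N T j "k \<circ> to_nat_on (params \<Omega> N)"
  proof (rule canonical.intro)
    show "henkin_set \<Omega> bot N (T n)" for n by (rule T(1))
    show "\<exists>n. \<alpha> \<notin> T n" if "wf_form \<Omega> \<alpha>" "\<not> provable \<Omega> \<alpha>" for \<alpha>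
    proof -
      have "\<alpha> \<in> range e" using e that by (simp add: For1_def)
      then show ?thesis using T(2) that(2) by blast
    qed
  qed (rule j i)+
  let ?\<mu> = "\<lambda>_ :: nat. (k \<circ> to_nat_on (params \<Omega> N)) (Var N)"
  have "range ?\<mu> \<subseteq> dom S"
    using Var_in_params by (auto simp: S_simps)
  then have "eval_fm S ?\<mu> \<phi> = bone (alg S)"
    using valid is_structure_S unfolding valid_def by blast
  moreover have "eval_fm S ?\<mu> \<phi> = j (h \<phi>)"
    using sen N by (rule eval_sentence_S)
  ultimately have "j (h \<phi>) = j UNIV" by (simp add: S_simps B_simps)
  then have "h \<phi> = UNIV" using j by (simp add: inj_eq)
  \<comment> \<open>Some \<open>T n\<close> omits the unprovable \<phi>, so its value cannot be the
    full set.\<close>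
  then show False using separating[OF wf unprovable] by (auto simp: h_def)
qed

lemma Sen_conj_list: "\<gamma>s \<noteq> [] \<Longrightarrow> set \<gamma>s \<subseteq> Sen \<Omega> \<Longrightarrow> conj_list \<gamma>s \<in> Sen \<Omega>"
  by (induction \<gamma>s rule: conj_list.induct) (auto simp: Sen_def For1_def)

theorem theorem7p22:
  fixes \<Omega> :: "('c, 'f, 'p) signature"
    and \<Gamma> :: "('c, 'f, 'p) fm set"
    and \<phi> :: "('c, 'f, 'p) fm"
  assumes "large_types TYPE('u) TYPE('a)"
    and "is_signature \<Omega>"
    and "\<Gamma> \<union> {\<phi>} \<subseteq> Sen \<Omega>"
    and "RQmbC_entails TYPE('u) TYPE('a) \<Omega> \<Gamma> \<phi>"
  shows "RQmbC_derives \<Omega> \<Gamma> \<phi>"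
proof -
  note complete = valid_imp_provable[OF assms(1,2)]
  \<comment> \<open>Consequence from \<Gamma> comes down to single implications with finitely many
    premises; these are again sentences, so completeness for validity applies to them.\<close>
  have "Imp (conj_list \<gamma>s) \<phi> \<in> Sen \<Omega>" if "\<gamma>s \<noteq> []" "set \<gamma>s \<subseteq> \<Gamma>" for \<gamma>s
    using Sen_conj_list[of \<gamma>s \<Omega>] that assms(3) by (auto simp: Sen_def For1_def)
  then show ?thesis
    using assms(3,4) complete unfolding RQmbC_entails_def RQmbC_derives_def by blast
qed

end
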